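(* Let $\mathcal{C}$ be an abelian category with enough projectives and let $(\mathcal{A},\mathcal{B})$ be a left $n$-cotorsion pair in $\mathcal{C}$ with $n\ge 3$. If the equality $\mathcal{A}={}^{\perp_1}\mathcal{B}$ holds, then the following conditions are equivalent: (a) Every object in $\mathcal{C}$ has an $\mathcal{A}$-envelope with the unique mapping property. (b) Every object in $\mathcal{C}$ has an $\mathcal{A}$-envelope and $\mathrm{resdim}_{\mathcal{A}}(\mathcal{C})\le 2$, that is, every object of $\mathcal{C}$ has $\mathcal{A}$-resolution dimension at most $2$.
   Context: $\mathrm{Ext}^i_{\mathcal{C}}(\mathcal{A},\mathcal{B})=0$ means $\mathrm{Ext}^i_{\mathcal{C}}(A,B)=0$ for all $A\in\mathcal{A}$, $B\in\mathcal{B}$. ${}^{\perp_1}\mathcal{B}=\{X:\mathrm{Ext}^1_{\mathcal{C}}(X,\mathcal{B})=0\}$. For a class $\mathcal{X}$, the $\mathcal{X}$-resolution dimension of $C$ is the smallest $m\ge0$ for which there is an exact sequence $0\to X_m\to\cdots\to X_0\to C\to 0$ with all $X_j\in\mathcal{X}$ ($\infty$ if none exists); $\mathcal{X}^\wedge_m$ is the class of objects of $\mathcal{X}$-resolution dimension $\le m$. Left $n$-cotorsion pair $(\mathcal{A},\mathcal{B})$: (1) $\mathcal{A}$ is closed under direct summands; (2) $\mathrm{Ext}^i_{\mathcal{C}}(\mathcal{A},\mathcal{B})=0$ for $1\le i\le n$; (3) for every $C\in\mathcal{C}$ there is a short exact sequence $0\to K\to A\to C\to 0$ with $A\in\mathcal{A}$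 and $K\in\mathcal{B}^\wedge_{n-1}$. An $\mathcal{A}$-preenvelope of $C$ is a morphism $f:C\to A$ with $A\in\mathcal{A}$ such that every $f':C\to A'$ with $A'\in\mathcal{A}$ is $f'=h\circ f$ for some $h:A\to A'$. It is an $\mathcal{A}$-envelope if, moreover, every $h:A\to A$ with $h\circ f=f$ is an automorphism. It has the unique mapping property if the factorizing $h$ is always unique. *)

theory Defs
  imports "HOL-Algebra.Elementary_Groups" "HOL-Library.Extended_Nat"
begin

text \<open>
  The hom-sets of a preadditive category are carried as abelian groups. Following the library
  convention for commutative groups, their addition is written multiplicatively; in particular
  \<open>\<one>\<^bsub>Hom C X Y\<^esub>\<close> is the zero morphism from \<open>X\<close> to \<open>Y\<close>. Composition is in the usual
  (right-to-left) order.
\<close>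

record ('o, 'm) precategory =
  Obj :: "'o set"
  Hom :: "'o \<Rightarrow> 'o \<Rightarrow> 'm monoid"
  Ident :: "'o \<Rightarrow> 'm"
  Comp :: "'m \<Rightarrow> 'm \<Rightarrow> 'm"  (infixr \<open>\<bullet>\<index>\<close> 75)

definition arr :: "('o, 'm) precategory \<Rightarrow> 'm \<Rightarrow> 'o \<Rightarrow> 'o \<Rightarrow> bool"
    (\<open>\<guillemotleft>_ : _ \<rightarrow>\<index> _\<guillemotright>\<close>)
  where "\<guillemotleft>f : X \<rightarrow>\<^bsub>C\<^esub> Y\<guillemotright> \<longleftrightarrow> X \<in> Obj C \<and> Y \<in> Obj C \<and> f \<in> carrier (Hom C X Y)"

locale preadditive_category =
  fixes C :: "('o, 'm) precategory" (structure)
  assumes arr_unique: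
      "\<lbrakk>\<guillemotleft>f : X \<rightarrow> Y\<guillemotright>; \<guillemotleft>f : X' \<rightarrow> Y'\<guillemotright>\<rbrakk> \<Longrightarrow> X = X' \<and> Y = Y'"
    and Ident_arr: "X \<in> Obj C \<Longrightarrow> \<guillemotleft>Ident C X : X \<rightarrow> X\<guillemotright>"
    and Comp_arr: "\<lbrakk>\<guillemotleft>g : Y \<rightarrow> Z\<guillemotright>; \<guillemotleft>f : X \<rightarrow> Y\<guillemotright>\<rbrakk> \<Longrightarrow> \<guillemotleft>g \<bullet> f : X \<rightarrow> Z\<guillemotright>"
    and Comp_assoc:
      "\<lbrakk>\<guillemotleft>h : Y \<rightarrow> Z\<guillemotright>; \<guillemotleft>g : X \<rightarrow> Y\<guillemotright>; \<guillemotleft>f : W \<rightarrow> X\<guillemotright>\<rbrakk> \<Longrightarrow> (h \<bullet> g) \<bullet> f = h \<bullet> (g \<bullet> f)"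
    and Comp_Ident_left: "\<guillemotleft>f : X \<rightarrow> Y\<guillemotright> \<Longrightarrow> Ident C Y \<bullet> f = f"
    and Comp_Ident_right: "\<guillemotleft>f : X \<rightarrow> Y\<guillemotright> \<Longrightarrow> f \<bullet> Ident C X = f"
    and Hom_comm_group: "\<lbrakk>X \<in> Obj C; Y \<in> Obj C\<rbrakk> \<Longrightarrow> comm_group (Hom C X Y)"
    and Comp_add_left:
      "\<lbrakk>\<guillemotleft>g : Y \<rightarrow> Z\<guillemotright>; \<guillemotleft>g' : Y \<rightarrow> Z\<guillemotright>; \<guillemotleft>f : X \<rightarrow> Y\<guillemotright>\<rbrakk> \<Longrightarrow>
        (g \<otimes>\<^bsub>Hom C Y Z\<^esub> g') \<bullet> f = (g \<bullet> f) \<otimes>\<^bsub>Hom C X Z\<^esub> (g' \<bullet> f)"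
    and Comp_add_right:
      "\<lbrakk>\<guillemotleft>g : Y \<rightarrow> Z\<guillemotright>; \<guillemotleft>f : X \<rightarrow> Y\<guillemotright>; \<guillemotleft>f' : X \<rightarrow> Y\<guillemotright>\<rbrakk> \<Longrightarrow>
        g \<bullet> (f \<otimes>\<^bsub>Hom C X Y\<^esub> f') = (g \<bullet> f) \<otimes>\<^bsub>Hom C X Z\<^esub> (g \<bullet> f')"

definition is_zero_object :: "('o, 'm) precategory \<Rightarrow> 'o \<Rightarrow> bool"
  where "is_zero_object C Z \<longleftrightarrow> Z \<in> Obj C \<and>
    (\<forall>X\<in>Obj C. (\<exists>!f. \<guillemotleft>f : X \<rightarrow>\<^bsub>C\<^esub> Z\<guillemotright>) \<and> (\<exists>!f. \<guillemotleft>f : Z \<rightarrow>\<^bsub>C\<^esub> X\<guillemotright>))"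

definition is_monic :: "('o, 'm) precategory \<Rightarrow> 'o \<Rightarrow> 'o \<Rightarrow> 'm \<Rightarrow> bool"
  where "is_monic C X Y f \<longleftrightarrow> \<guillemotleft>f : X \<rightarrow>\<^bsub>C\<^esub> Y\<guillemotright> \<and>
    (\<forall>W g h. \<guillemotleft>g : W \<rightarrow>\<^bsub>C\<^esub> X\<guillemotright> \<longrightarrow> \<guillemotleft>h : W \<rightarrow>\<^bsub>C\<^esub> X\<guillemotright> \<longrightarrow> f \<bullet>\<^bsub>C\<^esub> g = f \<bullet>\<^bsub>C\<^esub> h \<longrightarrow> g = h)"

definition is_epic :: "('o, 'm) precategory \<Rightarrow> 'o \<Rightarrow> 'o \<Rightarrow> 'm \<Rightarrow> bool"
  where "is_epic C X Y f \<longleftrightarrow> \<guillemotleft>f : X \<rightarrow>\<^bsub>C\<^esub> Y\<guillemotright> \<and>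
    (\<forall>W g h. \<guillemotleft>g : Y \<rightarrow>\<^bsub>C\<^esub> W\<guillemotright> \<longrightarrow> \<guillemotleft>h : Y \<rightarrow>\<^bsub>C\<^esub> W\<guillemotright> \<longrightarrow> g \<bullet>\<^bsub>C\<^esub> f = h \<bullet>\<^bsub>C\<^esub> f \<longrightarrow> g = h)"

definition is_automorphism :: "('o, 'm) precategory \<Rightarrow> 'o \<Rightarrow> 'm \<Rightarrow> bool"
  where "is_automorphism C X h \<longleftrightarrow> \<guillemotleft>h : X \<rightarrow>\<^bsub>C\<^esub> X\<guillemotright> \<and>
    (\<exists>k. \<guillemotleft>k : X \<rightarrow>\<^bsub>C\<^esub> X\<guillemotright> \<and> k \<bullet>\<^bsub>C\<^esub> h = Ident C X \<and> h \<bullet>\<^bsub>C\<^esub> k = Ident C X)"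

definition is_kernel :: "('o, 'm) precategory \<Rightarrow> 'o \<Rightarrow> 'o \<Rightarrow> 'm \<Rightarrow> 'o \<Rightarrow> 'm \<Rightarrow> bool"
  where "is_kernel C X Y f K k \<longleftrightarrow> \<guillemotleft>f : X \<rightarrow>\<^bsub>C\<^esub> Y\<guillemotright> \<and> \<guillemotleft>k : K \<rightarrow>\<^bsub>C\<^esub> X\<guillemotright> \<and>
    f \<bullet>\<^bsub>C\<^esub> k = \<one>\<^bsub>Hom C K Y\<^esub> \<and>
    (\<forall>W g. \<guillemotleft>g : W \<rightarrow>\<^bsub>C\<^esub> X\<guillemotright> \<longrightarrow> f \<bullet>\<^bsub>C\<^esub> g = \<one>\<^bsub>Hom C W Y\<^esub> \<longrightarrow>
      (\<exists>!u. \<guillemotleft>u : W \<rightarrow>\<^bsub>C\<^esub> K\<guillemotright> \<and> k \<bullet>\<^bsub>C\<^esub> u = g))"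

definition is_cokernel :: "('o, 'm) precategory \<Rightarrow> 'o \<Rightarrow> 'o \<Rightarrow> 'm \<Rightarrow> 'o \<Rightarrow> 'm \<Rightarrow> bool"
  where "is_cokernel C X Y f Q q \<longleftrightarrow> \<guillemotleft>f : X \<rightarrow>\<^bsub>C\<^esub> Y\<guillemotright> \<and> \<guillemotleft>q : Y \<rightarrow>\<^bsub>C\<^esub> Q\<guillemotright> \<and>
    q \<bullet>\<^bsub>C\<^esub> f = \<one>\<^bsub>Hom C X Q\<^esub> \<and>
    (\<forall>W g. \<guillemotleft>g : Y \<rightarrow>\<^bsub>C\<^esub> W\<guillemotright> \<longrightarrow> g \<bullet>\<^bsub>C\<^esub> f = \<one>\<^bsub>Hom C X W\<^esub> \<longrightarrow>
      (\<exists>!u. \<guillemotleft>u : Q \<rightarrow>\<^bsub>C\<^esub> W\<guillemotright> \<and> u \<bullet>\<^bsub>C\<^esub> q = g))"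

definition is_biproduct ::
    "('o, 'm) precategory \<Rightarrow> 'o \<Rightarrow> 'o \<Rightarrow> 'o \<Rightarrow> 'm \<Rightarrow> 'm \<Rightarrow> 'm \<Rightarrow> 'm \<Rightarrow> bool"
  where "is_biproduct C X Y S i j p q \<longleftrightarrow>
    \<guillemotleft>i : X \<rightarrow>\<^bsub>C\<^esub> S\<guillemotright> \<and> \<guillemotleft>j : Y \<rightarrow>\<^bsub>C\<^esub> S\<guillemotright> \<and> \<guillemotleft>p : S \<rightarrow>\<^bsub>C\<^esub> X\<guillemotright> \<and> \<guillemotleft>q : S \<rightarrow>\<^bsub>C\<^esub> Y\<guillemotright> \<and>
    p \<bullet>\<^bsub>C\<^esub> i = Ident C X \<and> q \<bullet>\<^bsub>C\<^esub> j = Ident C Y \<and>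
    (i \<bullet>\<^bsub>C\<^esub> p) \<otimes>\<^bsub>Hom C S S\<^esub> (j \<bullet>\<^bsub>C\<^esub> q) = Ident C S"

locale abelian_category = preadditive_category C
  for C :: "('o, 'm) precategory" (structure) +
  assumes ex_zero_object: "\<exists>Z. is_zero_object C Z"
    and ex_biproduct:
      "\<lbrakk>X \<in> Obj C; Y \<in> Obj C\<rbrakk> \<Longrightarrow> \<exists>S i j p q. is_biproduct C X Y S i j p q"
    and ex_kernel: "\<guillemotleft>f : X \<rightarrow> Y\<guillemotright> \<Longrightarrow> \<exists>K k. is_kernel C X Y f K k"
    and ex_cokernel: "\<guillemotleft>f : X \<rightarrow> Y\<guillemotright> \<Longrightarrow> \<exists>Q q. is_cokernel C X Y f Q q"
    and monic_is_kernel: "is_monic C X Y f \<Longrightarrow> \<exists>Z g. is_kernel C Y Z g X f"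
    and epic_is_cokernel: "is_epic C X Y f \<Longrightarrow> \<exists>W g. is_cokernel C W X g Y f"

text \<open>The image is the kernel of the cokernel; exactness means that the image of \<open>f\<close> and the
  kernel of \<open>g\<close> coincide as subobjects of \<open>Y\<close>.\<close>

definition is_image :: "('o, 'm) precategory \<Rightarrow> 'o \<Rightarrow> 'o \<Rightarrow> 'm \<Rightarrow> 'o \<Rightarrow> 'm \<Rightarrow> bool"
  where "is_image C X Y f I m \<longleftrightarrow> (\<exists>Q q. is_cokernel C X Y f Q q \<and> is_kernel C Y Q q I m)"

definition exact_at ::
    "('o, 'm) precategory \<Rightarrow> 'o \<Rightarrow> 'o \<Rightarrow> 'o \<Rightarrow> 'm \<Rightarrow> 'm \<Rightarrow> bool"
  where "exact_at C X Y Z f g \<longleftrightarrow> \<guillemotleft>f : X \<rightarrow>\<^bsub>C\<^esub> Y\<guillemotright> \<and> \<guillemotleft>g : Y \<rightarrow>\<^bsub>C\<^esub> Z\<guillemotright> \<and>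
    (\<exists>I m. is_image C X Y f I m \<and> is_kernel C Y Z g I m)"

text \<open>\<open>E N \<rightarrow> \<cdots> \<rightarrow> E 1 \<rightarrow> E 0\<close> with maps \<open>d j : E (j + 1) \<rightarrow> E j\<close>, exact at the inner objects
  \<open>E 1, \<dots>, E (N - 1)\<close>.\<close>

definition exact_chain ::
    "('o, 'm) precategory \<Rightarrow> nat \<Rightarrow> (nat \<Rightarrow> 'o) \<Rightarrow> (nat \<Rightarrow> 'm) \<Rightarrow> bool"
  where "exact_chain C N E d \<longleftrightarrow>
    (\<forall>j. j + 2 \<le> N \<longrightarrow> exact_at C (E (j + 2)) (E (j + 1)) (E j) (d (j + 1)) (d j))"

definition short_exact ::
    "('o, 'm) precategory \<Rightarrow> 'o \<Rightarrow> 'o \<Rightarrow> 'o \<Rightarrow> 'm \<Rightarrow> 'm \<Rightarrow> bool"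
  where "short_exact C K A X f g \<longleftrightarrow>
    (\<exists>Z Z' z z'. is_zero_object C Z \<and> is_zero_object C Z' \<and>
      exact_at C Z K A z f \<and> exact_at C K A X f g \<and> exact_at C A X Z' g z')"

definition is_projective :: "('o, 'm) precategory \<Rightarrow> 'o \<Rightarrow> bool"
  where "is_projective C P \<longleftrightarrow> P \<in> Obj C \<and>
    (\<forall>X Y e f. is_epic C X Y e \<longrightarrow> \<guillemotleft>f : P \<rightarrow>\<^bsub>C\<^esub> Y\<guillemotright> \<longrightarrow> (\<exists>g. \<guillemotleft>g : P \<rightarrow>\<^bsub>C\<^esub> X\<guillemotright> \<and> e \<bullet>\<^bsub>C\<^esub> g = f))"

definition enough_projectives :: "('o, 'm) precategory \<Rightarrow> bool"
  where "enough_projectives C \<longleftrightarrow>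
    (\<forall>X\<in>Obj C. \<exists>P e. is_projective C P \<and> is_epic C P X e)"

definition projective_resolution ::
    "('o, 'm) precategory \<Rightarrow> 'o \<Rightarrow> (nat \<Rightarrow> 'o) \<Rightarrow> (nat \<Rightarrow> 'm) \<Rightarrow> 'm \<Rightarrow> bool"
  where "projective_resolution C X P d \<epsilon> \<longleftrightarrow>
    (\<forall>i. is_projective C (P i)) \<and>
    (\<forall>i. exact_at C (P (i + 2)) (P (i + 1)) (P i) (d (i + 1)) (d i)) \<and>
    exact_at C (P 1) (P 0) X (d 0) \<epsilon> \<and>
    (\<exists>Z z. is_zero_object C Z \<and> exact_at C (P 0) X Z \<epsilon> z)"

text \<open>\<open>cohomology_of C P d Y i\<close> is the \<open>i\<close>-th cohomology group of the cochain complex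
  \<open>Hom (P 0) Y \<rightarrow> Hom (P 1) Y \<rightarrow> \<cdots>\<close> whose differentials are precomposition with \<open>d i\<close>.\<close>

definition cocycles ::
    "('o, 'm) precategory \<Rightarrow> (nat \<Rightarrow> 'o) \<Rightarrow> (nat \<Rightarrow> 'm) \<Rightarrow> 'o \<Rightarrow> nat \<Rightarrow> 'm set"
  where "cocycles C P d Y i =
    kernel (Hom C (P i) Y) (Hom C (P (Suc i)) Y) (\<lambda>\<phi>. \<phi> \<bullet>\<^bsub>C\<^esub> d i)"

definition coboundaries ::
    "('o, 'm) precategory \<Rightarrow> (nat \<Rightarrow> 'o) \<Rightarrow> (nat \<Rightarrow> 'm) \<Rightarrow> 'o \<Rightarrow> nat \<Rightarrow> 'm set"
  where "coboundaries C P d Y i =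
    (case i of 0 \<Rightarrow> {\<one>\<^bsub>Hom C (P 0) Y\<^esub>}
     | Suc j \<Rightarrow> (\<lambda>\<phi>. \<phi> \<bullet>\<^bsub>C\<^esub> d j) ` carrier (Hom C (P j) Y))"

definition cohomology_of ::
    "('o, 'm) precategory \<Rightarrow> (nat \<Rightarrow> 'o) \<Rightarrow> (nat \<Rightarrow> 'm) \<Rightarrow> 'o \<Rightarrow> nat \<Rightarrow> 'm set monoid"
  where "cohomology_of C P d Y i =
    (Hom C (P i) Y)\<lparr>carrier := cocycles C P d Y i\<rparr> Mod coboundaries C P d Y i"

text \<open>\<open>Ext C i X Y\<close> is the \<open>i\<close>-th right derived functor of \<open>Hom C _ Y\<close> at \<open>X\<close>, computed from a
  chosen projective resolution of \<open>X\<close>; it is meaningful when \<open>C\<close> has enough projectives and is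
  then independent of the choice up to isomorphism.\<close>

definition Ext :: "('o, 'm) precategory \<Rightarrow> nat \<Rightarrow> 'o \<Rightarrow> 'o \<Rightarrow> 'm set monoid"
  where "Ext C i X Y =
    (let (P, d, \<epsilon>) = (SOME (P, d, \<epsilon>). projective_resolution C X P d \<epsilon>)
     in cohomology_of C P d Y i)"

definition Ext_vanishes :: "('o, 'm) precategory \<Rightarrow> nat \<Rightarrow> 'o set \<Rightarrow> 'o set \<Rightarrow> bool"
  where "Ext_vanishes C i \<A> \<B> \<longleftrightarrow> (\<forall>A\<in>\<A>. \<forall>B\<in>\<B>. trivial_group (Ext C i A B))"

definition left_perp1 :: "('o, 'm) precategory \<Rightarrow> 'o set \<Rightarrow> 'o set"
  where "left_perp1 C \<B> = {X \<in> Obj C. Ext_vanishes C 1 {X} \<B>}"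

text \<open>An exact sequence \<open>0 \<rightarrow> X\<^sub>m \<rightarrow> \<cdots> \<rightarrow> X\<^sub>0 \<rightarrow> X \<rightarrow> 0\<close> is indexed with \<open>E 0 = 0\<close>, \<open>E 1 = X\<close>,
  \<open>E (j + 2) = X\<^sub>j\<close> and \<open>E (m + 3) = 0\<close>.\<close>

definition has_resolution_of_length ::
    "('o, 'm) precategory \<Rightarrow> 'o set \<Rightarrow> 'o \<Rightarrow> nat \<Rightarrow> bool"
  where "has_resolution_of_length C \<X> X m \<longleftrightarrow>
    (\<exists>E d. exact_chain C (m + 3) E d \<and> is_zero_object C (E 0) \<and> E 1 = X \<and>
      (\<forall>j\<le>m. E (j + 2) \<in> \<X>) \<and> is_zero_object C (E (m + 3)))"

text \<open>The infimum of the empty set in \<^typ>\<open>enat\<close> is \<open>\<infinity>\<close>; otherwise it is the least element.\<close>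

definition resdim :: "('o, 'm) precategory \<Rightarrow> 'o set \<Rightarrow> 'o \<Rightarrow> enat"
  where "resdim C \<X> X = Inf (enat ` {m. has_resolution_of_length C \<X> X m})"

definition resdim_le_class :: "('o, 'm) precategory \<Rightarrow> 'o set \<Rightarrow> nat \<Rightarrow> 'o set"
  where "resdim_le_class C \<X> m = {X \<in> Obj C. resdim C \<X> X \<le> enat m}"

definition closed_under_summands :: "('o, 'm) precategory \<Rightarrow> 'o set \<Rightarrow> bool"
  where "closed_under_summands C \<A> \<longleftrightarrow>
    (\<forall>A\<in>\<A>. \<forall>X Y i j p q. is_biproduct C X Y A i j p q \<longrightarrow> X \<in> \<A>)"

definition left_n_cotorsion_pair ::
    "('o, 'm) precategory \<Rightarrow> nat \<Rightarrow> 'o set \<Rightarrow> 'o set \<Rightarrow> bool"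
  where "left_n_cotorsion_pair C n \<A> \<B> \<longleftrightarrow>
    1 \<le> n \<and> \<A> \<subseteq> Obj C \<and> \<B> \<subseteq> Obj C \<and>
    closed_under_summands C \<A> \<and>
    (\<forall>i. 1 \<le> i \<and> i \<le> n \<longrightarrow> Ext_vanishes C i \<A> \<B>) \<and>
    (\<forall>X\<in>Obj C. \<exists>K A f g. short_exact C K A X f g \<and> A \<in> \<A> \<and> K \<in> resdim_le_class C \<B> (n - 1))"

definition is_preenvelope ::
    "('o, 'm) precategory \<Rightarrow> 'o set \<Rightarrow> 'o \<Rightarrow> 'o \<Rightarrow> 'm \<Rightarrow> bool"
  where "is_preenvelope C \<A> X A f \<longleftrightarrow> A \<in> \<A> \<and> \<guillemotleft>f : X \<rightarrow>\<^bsub>C\<^esub> A\<guillemotright> \<and>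
    (\<forall>A'\<in>\<A>. \<forall>f'. \<guillemotleft>f' : X \<rightarrow>\<^bsub>C\<^esub> A'\<guillemotright> \<longrightarrow> (\<exists>h. \<guillemotleft>h : A \<rightarrow>\<^bsub>C\<^esub> A'\<guillemotright> \<and> f' = h \<bullet>\<^bsub>C\<^esub> f))"

definition is_envelope ::
    "('o, 'm) precategory \<Rightarrow> 'o set \<Rightarrow> 'o \<Rightarrow> 'o \<Rightarrow> 'm \<Rightarrow> bool"
  where "is_envelope C \<A> X A f \<longleftrightarrow> is_preenvelope C \<A> X A f \<and>
    (\<forall>h. \<guillemotleft>h : A \<rightarrow>\<^bsub>C\<^esub> A\<guillemotright> \<longrightarrow> h \<bullet>\<^bsub>C\<^esub> f = f \<longrightarrow> is_automorphism C A h)"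

definition unique_mapping_property ::
    "('o, 'm) precategory \<Rightarrow> 'o set \<Rightarrow> 'o \<Rightarrow> 'o \<Rightarrow> 'm \<Rightarrow> bool"
  where "unique_mapping_property C \<A> X A f \<longleftrightarrow>
    (\<forall>A'\<in>\<A>. \<forall>f'. \<guillemotleft>f' : X \<rightarrow>\<^bsub>C\<^esub> A'\<guillemotright> \<longrightarrow> (\<exists>\<^sub>\<le>\<^sub>1 h. \<guillemotleft>h : A \<rightarrow>\<^bsub>C\<^esub> A'\<guillemotright> \<and> f' = h \<bullet>\<^bsub>C\<^esub> f))"

end

(*
  Write A for the left Ext^1-orthogonal class of B. Since Ext^2(A, B) = 0, the first syzygies of
  objects of A lie in A, which makes A resolving: it contains the projectives and is closed under
  extensions, retracts and kernels of epimorphisms.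

  (a) => (b): Let 0 -> K -> A1 -> A0 -> X -> 0 be exact with A0, A1 in A, and let K -> B be the
  envelope. The map K -> A1 extends to B -> A1, and by the unique mapping property B -> A1 -> A0
  vanishes. Hence B -> A1 factors through K, so K is a retract of B and lies in A.

  (b) => (a): If all resolution dimensions are at most 2, dimension shifting along pullbacks shows
  that the kernel of every map between objects of A lies in A. If two maps out of an envelope
  f : X -> A agree on X, then f factors through the kernel K -> A of their difference; the
  preenvelope property gives A -> K such that A -> K -> A fixes f, so it is an automorphism and
  the difference is zero.
*)

theory Submission
  imports Defs
begin

text \<open>\<open>Ext\<close> refers to one chosen projective resolution, which is awkward for
  diagram arguments. Its vanishing in degrees 1 and 2 is therefore turned into an extension
  property: Ext^1(X, Y) = 0 means that arrows K -> Y extend along every K -> M with cokernel X, and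
  Ext^2(X, Y) = 0 says the same for the first syzygy of X in the chosen resolution. From there on,
  all arguments are pullbacks of short exact sequences; no long exact sequence enters. The bound 2
  has the same origin in both directions: the kernel K of a map A1 -> A0 is a second syzygy of its
  cokernel X. A resolution of X of length at most 2 supplies another second syzygy, one that lies in
  \<A>, and the two have to be compared. Objects of \<A> need not be projective, so the sequences in
  Schanuel's lemma need not split; closure under extensions and kernels of epics takes the place of
  splitting.\<close>

lemma trivial_group_Mod:
  assumes "comm_group G" and H: "subgroup H G"
  shows "trivial_group (G Mod H) \<longleftrightarrow> H = carrier G"
proof -
  interpret comm_group G by fact
  interpret normal H G using normal_iff_subgroup H by blast
  have "trivial_group (G Mod H) \<longleftrightarrow> rcosets\<^bsub>G\<^esub> H = {H}"
    using factorgroup_is_group by (simp add: trivial_group_def FactGroup_def)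
  also have "\<dots> \<longleftrightarrow> H = carrier G"
  proof
    assume eq: "rcosets\<^bsub>G\<^esub> H = {H}"
    have "x \<in> H" if "x \<in> carrier G" for x
    proof -
      have "H #>\<^bsub>G\<^esub> x = H" using eq that by (auto simp: RCOSETS_def)
      then show ?thesis using rcos_self[OF that H] by simp
    qed
    then show "H = carrier G" using subset by blast
  next
    assume eq: "H = carrier G"
    have "H #>\<^bsub>G\<^esub> x = H" if "x \<in> carrier G" for x using that eq coset_join2 H by metis
    then show "rcosets\<^bsub>G\<^esub> H = {H}" unfolding RCOSETS_def using one_closed by auto
  qed
  finally show ?thesis .
qed

section \<open>Zero arrows and differences of arrows\<close>

context preadditive_category
begin

abbreviation zero_arr :: "'o \<Rightarrow> 'o \<Rightarrow> 'm"
  where "zero_arr X Y \<equiv> \<one>\<^bsub>Hom C X Y\<^esub>"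

definition diff :: "'o \<Rightarrow> 'o \<Rightarrow> 'm \<Rightarrow> 'm \<Rightarrow> 'm"
  where "diff X Y f g = f \<otimes>\<^bsub>Hom C X Y\<^esub> inv\<^bsub>Hom C X Y\<^esub> g"

lemma arr_Obj:
  assumes "\<guillemotleft>f : X \<rightarrow> Y\<guillemotright>"
  shows "X \<in> Obj C" "Y \<in> Obj C"
  using assms by (auto simp: arr_def)

lemma Hom_group: "\<lbrakk>X \<in> Obj C; Y \<in> Obj C\<rbrakk> \<Longrightarrow> group (Hom C X Y)"
  using Hom_comm_group comm_group.axioms(2) by blast

lemma zero_arr_arr: "\<lbrakk>X \<in> Obj C; Y \<in> Obj C\<rbrakk> \<Longrightarrow> \<guillemotleft>zero_arr X Y : X \<rightarrow> Y\<guillemotright>"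
  using Hom_group group.is_monoid monoid.one_closed unfolding arr_def by blast

text \<open>Additivity makes the composite an idempotent of the Hom group, and the unit is the only
  idempotent of a group.\<close>

lemma Comp_zero_right:
  assumes g: "\<guillemotleft>g : Y \<rightarrow> Z\<guillemotright>" and X: "X \<in> Obj C"
  shows "g \<bullet> zero_arr X Y = zero_arr X Z"
proof -
  note obj = arr_Obj[OF g]
  have z: "\<guillemotleft>zero_arr X Y : X \<rightarrow> Y\<guillemotright>" using zero_arr_arr X obj by blast
  interpret XY: group "Hom C X Y" using Hom_group X obj by blast
  interpret XZ: group "Hom C X Z" using Hom_group X obj by blast
  have c: "g \<bullet> zero_arr X Y \<in> carrier (Hom C X Z)" using Comp_arr[OF g z] by (simp add: arr_def)
  have "(g \<bullet> zero_arr X Y) \<otimes>\<^bsub>Hom C X Z\<^esub> (g \<bullet> zero_arr X Y) = g \<bullet> zero_arr X Y"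
    using Comp_add_right[OF g z z] by simp
  then show ?thesis using c by simp
qed

lemma Comp_zero_left:
  assumes f: "\<guillemotleft>f : X \<rightarrow> Y\<guillemotright>" and Z: "Z \<in> Obj C"
  shows "zero_arr Y Z \<bullet> f = zero_arr X Z"
proof -
  note obj = arr_Obj[OF f]
  have z: "\<guillemotleft>zero_arr Y Z : Y \<rightarrow> Z\<guillemotright>" using zero_arr_arr Z obj by blast
  interpret YZ: group "Hom C Y Z" using Hom_group Z obj by blast
  interpret XZ: group "Hom C X Z" using Hom_group Z obj by blast
  have c: "zero_arr Y Z \<bullet> f \<in> carrier (Hom C X Z)" using Comp_arr[OF z f] by (simp add: arr_def)
  have "(zero_arr Y Z \<bullet> f) \<otimes>\<^bsub>Hom C X Z\<^esub> (zero_arr Y Z \<bullet> f) = zero_arr Y Z \<bullet> f"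
    using Comp_add_left[OF z z f] by simp
  then show ?thesis using c by simp
qed

lemma diff_arr:
  assumes "\<guillemotleft>f : X \<rightarrow> Y\<guillemotright>" "\<guillemotleft>g : X \<rightarrow> Y\<guillemotright>"
  shows "\<guillemotleft>diff X Y f g : X \<rightarrow> Y\<guillemotright>"
proof -
  interpret XY: group "Hom C X Y" using Hom_group arr_Obj[OF assms(1)] by blast
  show ?thesis using assms by (simp add: arr_def diff_def)
qed

lemma diff_add:
  assumes "\<guillemotleft>f : X \<rightarrow> Y\<guillemotright>" "\<guillemotleft>g : X \<rightarrow> Y\<guillemotright>"
  shows "diff X Y f g \<otimes>\<^bsub>Hom C X Y\<^esub> g = f"
proof -
  interpret XY: group "Hom C X Y" using Hom_group arr_Obj[OF assms(1)] by blast
  show ?thesis using assms by (simp add: arr_def diff_def XY.m_assoc)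
qed

text \<open>A difference is determined by the sum that it solves. The additivity axioms of
  composition thereby carry over to differences without computing inverses of composites.\<close>

lemma diff_eqI:
  assumes "\<guillemotleft>d : X \<rightarrow> Y\<guillemotright>" "\<guillemotleft>g : X \<rightarrow> Y\<guillemotright>" "d \<otimes>\<^bsub>Hom C X Y\<^esub> g = f"
  shows "diff X Y f g = d"
proof -
  interpret XY: group "Hom C X Y" using Hom_group arr_Obj[OF assms(1)] by blast
  show ?thesis using assms by (auto simp: arr_def diff_def XY.m_assoc)
qed

lemma diff_zero_right: "\<guillemotleft>f : X \<rightarrow> Y\<guillemotright> \<Longrightarrow> diff X Y f (zero_arr X Y) = f"
proof -
  assume f: "\<guillemotleft>f : X \<rightarrow> Y\<guillemotright>"
  interpret XY: group "Hom C X Y" using Hom_group arr_Obj[OF f] by blast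
  show ?thesis using f by (simp add: arr_def diff_def)
qed

lemma diff_eq_zero_iff:
  assumes "\<guillemotleft>f : X \<rightarrow> Y\<guillemotright>" "\<guillemotleft>g : X \<rightarrow> Y\<guillemotright>"
  shows "diff X Y f g = zero_arr X Y \<longleftrightarrow> f = g"
proof -
  interpret XY: group "Hom C X Y" using Hom_group arr_Obj[OF assms(1)] by blast
  show ?thesis
    using diff_add[OF assms] assms by (auto simp: arr_def diff_def)
qed

lemma Comp_diff_right:
  assumes g: "\<guillemotleft>g : Y \<rightarrow> Z\<guillemotright>" and f: "\<guillemotleft>f : X \<rightarrow> Y\<guillemotright>" "\<guillemotleft>f' : X \<rightarrow> Y\<guillemotright>"
  shows "g \<bullet> diff X Y f f' = diff X Z (g \<bullet> f) (g \<bullet> f')"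
  using diff_eqI[of "g \<bullet> diff X Y f f'" X Z "g \<bullet> f'" "g \<bullet> f"]
    Comp_add_right[OF g diff_arr[OF f] f(2)] diff_add[OF f]
    Comp_arr[OF g diff_arr[OF f]] Comp_arr[OF g f(2)] by simp

lemma Comp_diff_left:
  assumes f: "\<guillemotleft>f : X \<rightarrow> Y\<guillemotright>" and g: "\<guillemotleft>g : Y \<rightarrow> Z\<guillemotright>" "\<guillemotleft>g' : Y \<rightarrow> Z\<guillemotright>"
  shows "diff Y Z g g' \<bullet> f = diff X Z (g \<bullet> f) (g' \<bullet> f)"
  using diff_eqI[of "diff Y Z g g' \<bullet> f" X Z "g' \<bullet> f" "g \<bullet> f"]
    Comp_add_left[OF diff_arr[OF g] g(2) f] diff_add[OF g]
    Comp_arr[OF diff_arr[OF g] f] Comp_arr[OF g(2) f] by simp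

section \<open>Epics, kernels and cokernels\<close>

text \<open>Two parallel arrows agree when their difference vanishes, so cancellation has to be
  tested against zero only.\<close>

lemma is_epicI:
  assumes e: "\<guillemotleft>e : X \<rightarrow> Y\<guillemotright>"
    and cancel: "\<And>W w. \<lbrakk>\<guillemotleft>w : Y \<rightarrow> W\<guillemotright>; w \<bullet> e = zero_arr X W\<rbrakk> \<Longrightarrow> w = zero_arr Y W"
  shows "is_epic C X Y e"
  unfolding is_epic_def
proof (intro conjI allI impI e)
  fix W g h
  assume gh: "\<guillemotleft>g : Y \<rightarrow> W\<guillemotright>" "\<guillemotleft>h : Y \<rightarrow> W\<guillemotright>" and eq: "g \<bullet> e = h \<bullet> e"
  have "diff Y W g h \<bullet> e = zero_arr X W"
    using Comp_diff_left[OF e gh] eq diff_eq_zero_iff Comp_arr[OF gh(2) e] by simp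
  then show "g = h" using cancel[OF diff_arr[OF gh]] diff_eq_zero_iff[OF gh] by simp
qed

lemma epic_arr: "is_epic C X Y e \<Longrightarrow> \<guillemotleft>e : X \<rightarrow> Y\<guillemotright>"
  by (simp add: is_epic_def)

lemma epic_cancel:
  "\<lbrakk>is_epic C X Y e; \<guillemotleft>g : Y \<rightarrow> W\<guillemotright>; \<guillemotleft>h : Y \<rightarrow> W\<guillemotright>; g \<bullet> e = h \<bullet> e\<rbrakk> \<Longrightarrow> g = h"
  unfolding is_epic_def by blast

lemma epic_cancel_zero:
  assumes "is_epic C X Y e" "\<guillemotleft>w : Y \<rightarrow> W\<guillemotright>" "w \<bullet> e = zero_arr X W"
  shows "w = zero_arr Y W"
  using epic_cancel[OF assms(1,2) zero_arr_arr] assms arr_Obj[OF assms(2)]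
    Comp_zero_left[OF epic_arr[OF assms(1)]] by metis

lemma epic_Comp:
  assumes e: "is_epic C X Y e" and f: "is_epic C Y Z f"
  shows "is_epic C X Z (f \<bullet> e)"
proof (rule is_epicI)
  note t = epic_arr[OF e] epic_arr[OF f]
  show "\<guillemotleft>f \<bullet> e : X \<rightarrow> Z\<guillemotright>" using Comp_arr t by blast
  fix W w assume w: "\<guillemotleft>w : Z \<rightarrow> W\<guillemotright>" "w \<bullet> (f \<bullet> e) = zero_arr X W"
  have "(w \<bullet> f) \<bullet> e = zero_arr X W" using Comp_assoc[OF w(1) t(2,1)] w(2) by simp
  then show "w = zero_arr Z W"
    using epic_cancel_zero[OF e Comp_arr[OF w(1) t(2)]] epic_cancel_zero[OF f w(1)] by blast
qed

lemma epic_Ident: "X \<in> Obj C \<Longrightarrow> is_epic C X X (Ident C X)"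
  unfolding is_epic_def by (metis Ident_arr Comp_Ident_right)

lemma kernel_arr:
  assumes "is_kernel C X Y f K k"
  shows "\<guillemotleft>f : X \<rightarrow> Y\<guillemotright>" "\<guillemotleft>k : K \<rightarrow> X\<guillemotright>" "f \<bullet> k = zero_arr K Y"
  using assms by (auto simp: is_kernel_def)

lemma kernel_lift:
  assumes "is_kernel C X Y f K k" "\<guillemotleft>g : W \<rightarrow> X\<guillemotright>" "f \<bullet> g = zero_arr W Y"
  obtains u where "\<guillemotleft>u : W \<rightarrow> K\<guillemotright>" "k \<bullet> u = g"
  using assms unfolding is_kernel_def by blast

lemma kernel_cancel:
  assumes k: "is_kernel C X Y f K k" and u: "\<guillemotleft>u : W \<rightarrow> K\<guillemotright>" "\<guillemotleft>v : W \<rightarrow> K\<guillemotright>" and eq: "k \<bullet> u = k \<bullet> v"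
  shows "u = v"
proof -
  note t = kernel_arr[OF k]
  have "f \<bullet> (k \<bullet> v) = zero_arr W Y"
    using Comp_assoc[OF t(1,2) u(2)] t(3) Comp_zero_left[OF u(2)] arr_Obj[OF t(1)] by simp
  then have "\<exists>!w. \<guillemotleft>w : W \<rightarrow> K\<guillemotright> \<and> k \<bullet> w = k \<bullet> v"
    using k Comp_arr[OF t(2) u(2)] unfolding is_kernel_def by blast
  then show ?thesis using u eq by blast
qed

lemma kernel_monic: "is_kernel C X Y f K k \<Longrightarrow> is_monic C K X k"
  unfolding is_monic_def using kernel_arr(2) kernel_cancel by meson

text \<open>Monicity of \<open>k\<close> supplies the uniqueness in the universal property, so only
  existence of factorizations is left to check.\<close>

lemma is_kernelI:
  assumes "\<guillemotleft>f : X \<rightarrow> Y\<guillemotright>" "is_monic C K X k" "f \<bullet> k = zero_arr K Y"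
    and "\<And>W g. \<lbrakk>\<guillemotleft>g : W \<rightarrow> X\<guillemotright>; f \<bullet> g = zero_arr W Y\<rbrakk> \<Longrightarrow> \<exists>u. \<guillemotleft>u : W \<rightarrow> K\<guillemotright> \<and> k \<bullet> u = g"
  shows "is_kernel C X Y f K k"
  using assms unfolding is_kernel_def is_monic_def by metis

lemma monic_Comp:
  assumes e: "is_monic C X Y e" and f: "is_monic C Y Z f"
  shows "is_monic C X Z (f \<bullet> e)"
  unfolding is_monic_def
proof (intro conjI allI impI)
  have t: "\<guillemotleft>e : X \<rightarrow> Y\<guillemotright>" "\<guillemotleft>f : Y \<rightarrow> Z\<guillemotright>" using e f by (auto simp: is_monic_def)
  show "\<guillemotleft>f \<bullet> e : X \<rightarrow> Z\<guillemotright>" using Comp_arr t by blast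
  fix W g h assume gh: "\<guillemotleft>g : W \<rightarrow> X\<guillemotright>" "\<guillemotleft>h : W \<rightarrow> X\<guillemotright>" and eq: "(f \<bullet> e) \<bullet> g = (f \<bullet> e) \<bullet> h"
  have "f \<bullet> (e \<bullet> g) = f \<bullet> (e \<bullet> h)"
    using Comp_assoc[OF t(2,1) gh(1)] Comp_assoc[OF t(2,1) gh(2)] eq by simp
  then have "e \<bullet> g = e \<bullet> h"
    using f Comp_arr[OF t(1) gh(1)] Comp_arr[OF t(1) gh(2)] unfolding is_monic_def by blast
  then show "g = h" using e gh unfolding is_monic_def by blast
qed

text \<open>A monic kills nothing. Together with its converse \<open>kernel_of_Comp_monic\<close>,
  this allows a differential to be exchanged for its epic part without changing the kernel.\<close>

lemma kernel_Comp_monic: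
  assumes k: "is_kernel C X Y f K k" and m: "is_monic C Y Z m"
  shows "is_kernel C X Z (m \<bullet> f) K k"
proof (rule is_kernelI)
  note t = kernel_arr[OF k]
  have m': "\<guillemotleft>m : Y \<rightarrow> Z\<guillemotright>" using m by (simp add: is_monic_def)
  show "\<guillemotleft>m \<bullet> f : X \<rightarrow> Z\<guillemotright>" using Comp_arr m' t by blast
  show "is_monic C K X k" using kernel_monic k .
  show "(m \<bullet> f) \<bullet> k = zero_arr K Z"
    using Comp_assoc[OF m' t(1,2)] t(3) Comp_zero_right[OF m'] arr_Obj[OF t(2)] by simp
  fix W g assume g: "\<guillemotleft>g : W \<rightarrow> X\<guillemotright>" "(m \<bullet> f) \<bullet> g = zero_arr W Z"
  have fg: "\<guillemotleft>f \<bullet> g : W \<rightarrow> Y\<guillemotright>" using Comp_arr t g by blast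
  have W: "W \<in> Obj C" "Y \<in> Obj C" using arr_Obj[OF fg] .
  have "m \<bullet> (f \<bullet> g) = m \<bullet> zero_arr W Y"
    using Comp_assoc[OF m' t(1) g(1)] g(2) Comp_zero_right[OF m'] W by simp
  then have "f \<bullet> g = zero_arr W Y"
    using m fg zero_arr_arr[OF W] unfolding is_monic_def by blast
  then show "\<exists>u. \<guillemotleft>u : W \<rightarrow> K\<guillemotright> \<and> k \<bullet> u = g" using kernel_lift[OF k g(1)] by metis
qed

lemma kernel_of_Comp_monic:
  assumes f: "\<guillemotleft>f : X \<rightarrow> Y\<guillemotright>" and m: "\<guillemotleft>m : Y \<rightarrow> Z\<guillemotright>" "is_monic C Y Z m"
    and k: "is_kernel C X Z (m \<bullet> f) K k"
  shows "is_kernel C X Y f K k"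
proof (rule is_kernelI[OF f kernel_monic[OF k]])
  note t = kernel_arr[OF k]
  have fk: "\<guillemotleft>f \<bullet> k : K \<rightarrow> Y\<guillemotright>" using Comp_arr f t by blast
  note obj = arr_Obj[OF fk]
  have "m \<bullet> (f \<bullet> k) = m \<bullet> zero_arr K Y"
    using Comp_assoc[OF m(1) f t(2)] t(3) Comp_zero_right[OF m(1)] obj by simp
  then show "f \<bullet> k = zero_arr K Y"
    using m(2) fk zero_arr_arr[OF obj] unfolding is_monic_def by blast
  fix W g assume g: "\<guillemotleft>g : W \<rightarrow> X\<guillemotright>" "f \<bullet> g = zero_arr W Y"
  have "(m \<bullet> f) \<bullet> g = zero_arr W Z"
    using Comp_assoc[OF m(1) f g(1)] g(2) Comp_zero_right[OF m(1)] arr_Obj[OF g(1)] by simp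
  then show "\<exists>u. \<guillemotleft>u : W \<rightarrow> K\<guillemotright> \<and> k \<bullet> u = g" using kernel_lift[OF k g(1)] by metis
qed

lemma cokernel_arr:
  assumes "is_cokernel C X Y f Q q"
  shows "\<guillemotleft>f : X \<rightarrow> Y\<guillemotright>" "\<guillemotleft>q : Y \<rightarrow> Q\<guillemotright>" "q \<bullet> f = zero_arr X Q"
  using assms by (auto simp: is_cokernel_def)

lemma cokernel_lift:
  assumes "is_cokernel C X Y f Q q" "\<guillemotleft>g : Y \<rightarrow> W\<guillemotright>" "g \<bullet> f = zero_arr X W"
  obtains u where "\<guillemotleft>u : Q \<rightarrow> W\<guillemotright>" "u \<bullet> q = g"
  using assms unfolding is_cokernel_def by blast

lemma cokernel_epic:
  assumes q: "is_cokernel C X Y f Q q"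
  shows "is_epic C Y Q q"
proof (rule is_epicI)
  note t = cokernel_arr[OF q]
  show "\<guillemotleft>q : Y \<rightarrow> Q\<guillemotright>" by fact
  fix W w assume w: "\<guillemotleft>w : Q \<rightarrow> W\<guillemotright>" "w \<bullet> q = zero_arr Y W"
  have W: "W \<in> Obj C" "Q \<in> Obj C" "Y \<in> Obj C" using arr_Obj w(1) t(2) by blast+
  have "\<exists>!u. \<guillemotleft>u : Q \<rightarrow> W\<guillemotright> \<and> u \<bullet> q = zero_arr Y W"
    using q zero_arr_arr[OF W(3,1)] Comp_zero_left[OF t(1) W(1)] unfolding is_cokernel_def by blast
  then show "w = zero_arr Q W"
    using w zero_arr_arr[OF W(2,1)] Comp_zero_left[OF t(2) W(1)] by blast
qed

section \<open>Short exact sequences and pullbacks\<close>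

text \<open>A short exact sequence 0 -> K -> M -> X -> 0 without images or zero objects. That
  \<open>e\<close> is then also the cokernel of \<open>k\<close> is a theorem in abelian categories,
  \<open>extension_descend\<close>.\<close>

definition is_extension :: "'o \<Rightarrow> 'o \<Rightarrow> 'o \<Rightarrow> 'm \<Rightarrow> 'm \<Rightarrow> bool"
  where "is_extension K M X k e \<longleftrightarrow> is_kernel C M X e K k \<and> is_epic C M X e"

definition is_pullback ::
    "'o \<Rightarrow> 'o \<Rightarrow> 'o \<Rightarrow> 'm \<Rightarrow> 'm \<Rightarrow> 'o \<Rightarrow> 'm \<Rightarrow> 'm \<Rightarrow> bool"
  where "is_pullback X Y Z f g P p q \<longleftrightarrow>
    \<guillemotleft>f : X \<rightarrow> Z\<guillemotright> \<and> \<guillemotleft>g : Y \<rightarrow> Z\<guillemotright> \<and> \<guillemotleft>p : P \<rightarrow> X\<guillemotright> \<and> \<guillemotleft>q : P \<rightarrow> Y\<guillemotright> \<and> f \<bullet> p = g \<bullet> q \<and>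
    (\<forall>W a b. \<guillemotleft>a : W \<rightarrow> X\<guillemotright> \<longrightarrow> \<guillemotleft>b : W \<rightarrow> Y\<guillemotright> \<longrightarrow> f \<bullet> a = g \<bullet> b \<longrightarrow>
      (\<exists>!u. \<guillemotleft>u : W \<rightarrow> P\<guillemotright> \<and> p \<bullet> u = a \<and> q \<bullet> u = b))"

lemma is_pullback_sym: "is_pullback X Y Z f g P p q \<Longrightarrow> is_pullback Y X Z g f P q p"
  unfolding is_pullback_def by (simp add: conj_commute conj_left_commute)

lemma pullback_arr:
  assumes "is_pullback X Y Z f g P p q"
  shows "\<guillemotleft>f : X \<rightarrow> Z\<guillemotright>" "\<guillemotleft>g : Y \<rightarrow> Z\<guillemotright>" "\<guillemotleft>p : P \<rightarrow> X\<guillemotright>" "\<guillemotleft>q : P \<rightarrow> Y\<guillemotright>" "f \<bullet> p = g \<bullet> q"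
  using assms by (auto simp: is_pullback_def)

lemma pullback_lift:
  assumes "is_pullback X Y Z f g P p q" "\<guillemotleft>a : W \<rightarrow> X\<guillemotright>" "\<guillemotleft>b : W \<rightarrow> Y\<guillemotright>" "f \<bullet> a = g \<bullet> b"
  obtains u where "\<guillemotleft>u : W \<rightarrow> P\<guillemotright>" "p \<bullet> u = a" "q \<bullet> u = b"
  using assms unfolding is_pullback_def by blast

lemma pullback_cancel:
  assumes pb: "is_pullback X Y Z f g P p q" and u: "\<guillemotleft>u : W \<rightarrow> P\<guillemotright>" "\<guillemotleft>v : W \<rightarrow> P\<guillemotright>"
    and eq: "p \<bullet> u = p \<bullet> v" "q \<bullet> u = q \<bullet> v"
  shows "u = v"
proof -
  note t = pullback_arr[OF pb]
  have "f \<bullet> (p \<bullet> v) = g \<bullet> (q \<bullet> v)"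
    using Comp_assoc[OF t(1,3) u(2)] Comp_assoc[OF t(2,4) u(2)] t(5) by simp
  then have "\<exists>!w. \<guillemotleft>w : W \<rightarrow> P\<guillemotright> \<and> p \<bullet> w = p \<bullet> v \<and> q \<bullet> w = q \<bullet> v"
    using pb Comp_arr[OF t(3) u(2)] Comp_arr[OF t(4) u(2)] unfolding is_pullback_def by blast
  then show ?thesis using u eq by blast
qed

text \<open>The arrow \<open>k'\<close> is the lift of the pair (\<open>k\<close>, 0): opposite
  sides of a pullback square have the same kernel.\<close>

lemma pullback_kernel:
  assumes pb: "is_pullback X Y Z f g P p q" and k: "is_kernel C X Z f K k"
  obtains k' where "is_kernel C P Y q K k'" "p \<bullet> k' = k"
proof -
  note t = pullback_arr[OF pb] and s = kernel_arr[OF k]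
  have obj: "K \<in> Obj C" "Y \<in> Obj C" using arr_Obj t s by blast+
  have "f \<bullet> k = g \<bullet> zero_arr K Y" using s(3) Comp_zero_right[OF t(2)] obj by simp
  then obtain k' where k': "\<guillemotleft>k' : K \<rightarrow> P\<guillemotright>" "p \<bullet> k' = k" "q \<bullet> k' = zero_arr K Y"
    using pullback_lift[OF pb s(2) zero_arr_arr[OF obj]] by metis
  have "is_kernel C P Y q K k'"
  proof (rule is_kernelI[OF t(4) _ k'(3)])
    show "is_monic C K P k'"
      unfolding is_monic_def
    proof (intro conjI allI impI)
      show "\<guillemotleft>k' : K \<rightarrow> P\<guillemotright>" by fact
      fix W a b assume ab: "\<guillemotleft>a : W \<rightarrow> K\<guillemotright>" "\<guillemotleft>b : W \<rightarrow> K\<guillemotright>" "k' \<bullet> a = k' \<bullet> b"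
      have "k \<bullet> a = k \<bullet> b"
        using Comp_assoc[OF t(3) k'(1) ab(1)] Comp_assoc[OF t(3) k'(1) ab(2)] ab(3) k'(2) by simp
      then show "a = b" using kernel_cancel[OF k ab(1,2)] by blast
    qed
    fix W a assume a: "\<guillemotleft>a : W \<rightarrow> P\<guillemotright>" "q \<bullet> a = zero_arr W Y"
    have W: "W \<in> Obj C" using arr_Obj a by blast
    have "f \<bullet> (p \<bullet> a) = zero_arr W Z"
      using Comp_assoc[OF t(1,3) a(1)] Comp_assoc[OF t(2,4) a(1)] t(5) a(2)
        Comp_zero_right[OF t(2) W] by simp
    then obtain u where u: "\<guillemotleft>u : W \<rightarrow> K\<guillemotright>" "k \<bullet> u = p \<bullet> a"
      using kernel_lift[OF k Comp_arr[OF t(3) a(1)]] by blast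
    have "p \<bullet> (k' \<bullet> u) = p \<bullet> a" using Comp_assoc[OF t(3) k'(1) u(1)] k'(2) u(2) by simp
    moreover have "q \<bullet> (k' \<bullet> u) = q \<bullet> a"
      using Comp_assoc[OF t(4) k'(1) u(1)] k'(3) a(2) Comp_zero_left[OF u(1)] obj by simp
    ultimately have "k' \<bullet> u = a"
      using pullback_cancel[OF pb Comp_arr[OF k'(1) u(1)] a(1)] by blast
    then show "\<exists>u. \<guillemotleft>u : W \<rightarrow> K\<guillemotright> \<and> k' \<bullet> u = a" using u by blast
  qed
  then show thesis using that k' by blast
qed

text \<open>The pullback of a subobject is its preimage: an arrow into X lands in the preimage of
  the kernel of \<open>h\<close> exactly when \<open>h \<bullet> f\<close> kills it.\<close>

lemma pullback_of_kernel:
  assumes pb: "is_pullback X Y Z f g P p q" and g: "is_kernel C Z V h Y g"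
  shows "is_kernel C X V (h \<bullet> f) P p"
proof (rule is_kernelI)
  note t = pullback_arr[OF pb] and s = kernel_arr[OF g]
  show "\<guillemotleft>h \<bullet> f : X \<rightarrow> V\<guillemotright>" using Comp_arr s t by blast
  show "(h \<bullet> f) \<bullet> p = zero_arr P V"
    using Comp_assoc[OF s(1) t(1,3)] Comp_assoc[OF s(1,2) t(4)] t(5) s(3)
      Comp_zero_left[OF t(4)] arr_Obj[OF s(1)] by simp
  show "is_monic C P X p"
    unfolding is_monic_def
  proof (intro conjI allI impI)
    show "\<guillemotleft>p : P \<rightarrow> X\<guillemotright>" by fact
    fix W a b assume ab: "\<guillemotleft>a : W \<rightarrow> P\<guillemotright>" "\<guillemotleft>b : W \<rightarrow> P\<guillemotright>" "p \<bullet> a = p \<bullet> b"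
    have "g \<bullet> (q \<bullet> a) = g \<bullet> (q \<bullet> b)"
      using Comp_assoc[OF t(2,4) ab(1)] Comp_assoc[OF t(2,4) ab(2)]
        Comp_assoc[OF t(1,3) ab(1)] Comp_assoc[OF t(1,3) ab(2)] t(5) ab(3) by simp
    then have "q \<bullet> a = q \<bullet> b"
      using kernel_cancel[OF g] Comp_arr[OF t(4) ab(1)] Comp_arr[OF t(4) ab(2)] by blast
    then show "a = b" using pullback_cancel[OF pb ab(1,2,3)] by blast
  qed
  fix W a assume a: "\<guillemotleft>a : W \<rightarrow> X\<guillemotright>" "(h \<bullet> f) \<bullet> a = zero_arr W V"
  have "h \<bullet> (f \<bullet> a) = zero_arr W V" using Comp_assoc[OF s(1) t(1) a(1)] a(2) by simp
  then obtain b where "\<guillemotleft>b : W \<rightarrow> Y\<guillemotright>" "g \<bullet> b = f \<bullet> a"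
    using kernel_lift[OF g Comp_arr[OF t(1) a(1)]] by blast
  then show "\<exists>u. \<guillemotleft>u : W \<rightarrow> P\<guillemotright> \<and> p \<bullet> u = a" using pullback_lift[OF pb a(1)] by metis
qed

end

section \<open>Pullbacks and exactness in abelian categories\<close>

context abelian_category
begin

text \<open>The epic \<open>e\<close> is the cokernel of some \<open>a\<close>. As \<open>e\<close>
  kills \<open>a\<close>, \<open>a\<close> factors through the kernel \<open>k\<close>, so whatever
  kills \<open>k\<close> also kills \<open>a\<close> and descends.\<close>

lemma extension_descend:
  assumes ext: "is_extension K M X k e" and g: "\<guillemotleft>g : M \<rightarrow> W\<guillemotright>" "g \<bullet> k = zero_arr K W"
  obtains u where "\<guillemotleft>u : X \<rightarrow> W\<guillemotright>" "u \<bullet> e = g"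
proof -
  have k: "is_kernel C M X e K k" and e: "is_epic C M X e" using ext by (auto simp: is_extension_def)
  note t = kernel_arr[OF k]
  obtain V a where a: "is_cokernel C V M a X e" using epic_is_cokernel[OF e] by blast
  note s = cokernel_arr[OF a]
  obtain a' where a': "\<guillemotleft>a' : V \<rightarrow> K\<guillemotright>" "k \<bullet> a' = a" using kernel_lift[OF k s(1,3)] by blast
  have "g \<bullet> a = zero_arr V W"
    using Comp_assoc[OF g(1) t(2) a'(1)] a'(2) g(2) Comp_zero_left[OF a'(1)] arr_Obj[OF g(1)] by simp
  then show thesis using cokernel_lift[OF a g(1)] that by blast
qed

text \<open>The dual of \<open>extension_descend\<close>: a monic is the kernel of its own
  cokernel.\<close>

lemma monic_lift:
  assumes m: "is_monic C X Y m" and q: "is_cokernel C X Y m Q q"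
    and a: "\<guillemotleft>a : W \<rightarrow> Y\<guillemotright>" "q \<bullet> a = zero_arr W Q"
  obtains u where "\<guillemotleft>u : W \<rightarrow> X\<guillemotright>" "m \<bullet> u = a"
proof -
  obtain Z z where z: "is_kernel C Y Z z X m" using monic_is_kernel[OF m] by blast
  note t = kernel_arr[OF z] and s = cokernel_arr[OF q]
  obtain z' where z': "\<guillemotleft>z' : Q \<rightarrow> Z\<guillemotright>" "z' \<bullet> q = z" using cokernel_lift[OF q t(1,3)] by blast
  have "z \<bullet> a = zero_arr W Z"
    using Comp_assoc[OF z'(1) s(2) a(1)] z'(2) a(2) Comp_zero_right[OF z'(1)] arr_Obj[OF a(1)] by simp
  then show thesis using kernel_lift[OF z a(1)] that by blast
qed

text \<open>The image is the smallest subobject through which \<open>f\<close> factors. If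
  \<open>w\<close> kills \<open>e\<close>, then \<open>f\<close> already factors through the kernel
  of \<open>w\<close>, a subobject of the image; that subobject must then be the whole image, and
  \<open>w\<close> is zero.\<close>

lemma image_factor:
  assumes im: "is_image C X Y f I m"
  obtains e where "is_epic C X I e" "m \<bullet> e = f"
proof -
  obtain Q q where q: "is_cokernel C X Y f Q q" and m: "is_kernel C Y Q q I m"
    using im unfolding is_image_def by blast
  note t = cokernel_arr[OF q] and s = kernel_arr[OF m]
  obtain e where e: "\<guillemotleft>e : X \<rightarrow> I\<guillemotright>" "m \<bullet> e = f" using kernel_lift[OF m t(1,3)] by blast
  have I: "I \<in> Obj C" using arr_Obj s by blast
  have "is_epic C X I e"
  proof (rule is_epicI[OF e(1)])
    fix W w assume w: "\<guillemotleft>w : I \<rightarrow> W\<guillemotright>" "w \<bullet> e = zero_arr X W"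
    obtain K k where k: "is_kernel C I W w K k" using ex_kernel[OF w(1)] by blast
    note r = kernel_arr[OF k]
    obtain e' where e': "\<guillemotleft>e' : X \<rightarrow> K\<guillemotright>" "k \<bullet> e' = e" using kernel_lift[OF k e(1) w(2)] by blast
    have mk: "\<guillemotleft>m \<bullet> k : K \<rightarrow> Y\<guillemotright>" using Comp_arr s r by blast
    have mon: "is_monic C K Y (m \<bullet> k)" using monic_Comp kernel_monic k m by blast
    obtain V c where c: "is_cokernel C K Y (m \<bullet> k) V c" using ex_cokernel[OF mk] by blast
    note v = cokernel_arr[OF c]
    \<comment> \<open>The cokernel \<open>c\<close> of the smaller subobject kills \<open>f\<close>,
      hence factors through \<open>q\<close> and kills \<open>m\<close> as well. So \<open>m\<close>
      lifts along \<open>m \<bullet> k\<close>, which gives \<open>k\<close> a right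
      inverse.\<close>
    have "c \<bullet> f = (c \<bullet> (m \<bullet> k)) \<bullet> e'"
      using Comp_assoc[OF v(2) mk e'(1)] Comp_assoc[OF s(2) r(2) e'(1)] e' e(2) by simp
    also have "\<dots> = zero_arr X V" using v(3) Comp_zero_left[OF e'(1)] arr_Obj[OF v(2)] by simp
    finally obtain c' where c': "\<guillemotleft>c' : Q \<rightarrow> V\<guillemotright>" "c' \<bullet> q = c" using cokernel_lift[OF q v(2)] by blast
    have "c \<bullet> m = zero_arr I V"
      using Comp_assoc[OF c'(1) t(2) s(2)] c'(2) s(3) Comp_zero_right[OF c'(1) I] by simp
    then obtain u where u: "\<guillemotleft>u : I \<rightarrow> K\<guillemotright>" "(m \<bullet> k) \<bullet> u = m" using monic_lift[OF mon c s(2)] by blast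
    have "m \<bullet> (k \<bullet> u) = m \<bullet> Ident C I"
      using Comp_assoc[OF s(2) r(2) u(1)] u(2) Comp_Ident_right[OF s(2)] by simp
    then have ku: "k \<bullet> u = Ident C I"
      using kernel_cancel[OF m Comp_arr[OF r(2) u(1)] Ident_arr[OF I]] by blast
    have "w = w \<bullet> (k \<bullet> u)" using ku Comp_Ident_right[OF w(1)] by simp
    also have "\<dots> = zero_arr I W"
      using Comp_assoc[OF w(1) r(2) u(1)] r(3) Comp_zero_left[OF u(1)] arr_Obj[OF w(1)] by simp
    finally show "w = zero_arr I W" .
  qed
  then show thesis using that e(2) by blast
qed

lemma epic_monic_factorization:
  assumes f: "\<guillemotleft>f : X \<rightarrow> Y\<guillemotright>"
  obtains I m e Q q where "is_extension I Y Q m q" "is_epic C X I e" "f = m \<bullet> e"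
proof -
  obtain Q q where q: "is_cokernel C X Y f Q q" using ex_cokernel[OF f] by blast
  obtain I m where m: "is_kernel C Y Q q I m" using ex_kernel cokernel_arr(2)[OF q] by blast
  have "is_image C X Y f I m" using q m unfolding is_image_def by blast
  then obtain e where "is_epic C X I e" "m \<bullet> e = f" by (rule image_factor)
  then show thesis using that m cokernel_epic[OF q] unfolding is_extension_def by blast
qed

text \<open>The image of \<open>f\<close> and the given \<open>K\<close> are both kernels of
  \<open>g\<close>. Comparing them carries the epic onto the image over to an epic onto
  \<open>K\<close>.\<close>

lemma exact_at_factor:
  assumes ex: "exact_at C X Y Z f g" and k: "is_kernel C Y Z g K k"
  obtains e where "is_epic C X K e" "f = k \<bullet> e"
proof -
  obtain I m where im: "is_image C X Y f I m" and m: "is_kernel C Y Z g I m"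
    using ex unfolding exact_at_def by blast
  obtain e where e: "is_epic C X I e" "m \<bullet> e = f" using image_factor[OF im] by blast
  note t = kernel_arr[OF k] and s = kernel_arr[OF m]
  obtain u where u: "\<guillemotleft>u : K \<rightarrow> I\<guillemotright>" "m \<bullet> u = k" using kernel_lift[OF m t(2,3)] by blast
  obtain v where v: "\<guillemotleft>v : I \<rightarrow> K\<guillemotright>" "k \<bullet> v = m" using kernel_lift[OF k s(2,3)] by blast
  have K: "K \<in> Obj C" using arr_Obj u by blast
  have "k \<bullet> (v \<bullet> u) = k \<bullet> Ident C K"
    using Comp_assoc[OF t(2) v(1) u(1)] u(2) v(2) Comp_Ident_right[OF t(2)] by simp
  then have vu: "v \<bullet> u = Ident C K"
    using kernel_cancel[OF k Comp_arr[OF v(1) u(1)] Ident_arr[OF K]] by blast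
  have "is_epic C I K v"
  proof (rule is_epicI[OF v(1)])
    fix W w assume w: "\<guillemotleft>w : K \<rightarrow> W\<guillemotright>" "w \<bullet> v = zero_arr I W"
    have "w = w \<bullet> (v \<bullet> u)" using vu Comp_Ident_right[OF w(1)] by simp
    also have "\<dots> = zero_arr K W"
      using Comp_assoc[OF w(1) v(1) u(1)] w(2) Comp_zero_left[OF u(1)] arr_Obj[OF w(1)] by simp
    finally show "w = zero_arr K W" .
  qed
  then have "is_epic C X K (v \<bullet> e)" using epic_Comp e(1) by blast
  moreover have "f = k \<bullet> (v \<bullet> e)"
    using Comp_assoc[OF t(2) v(1) epic_arr[OF e(1)]] v(2) e(2) by simp
  ultimately show thesis using that by blast
qed

text \<open>Since \<open>e\<close> is epic, \<open>k \<bullet> e\<close> and \<open>k\<close> have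
  the same cokernel \<open>q\<close>. Since \<open>g\<close> factors through \<open>q\<close>,
  arrows killed by \<open>q\<close> are killed by \<open>g\<close> and lift along \<open>k\<close>;
  thus \<open>k\<close> is also the image.\<close>

lemma exact_atI:
  assumes k: "is_kernel C Y Z g K k" and e: "is_epic C X K e"
  shows "exact_at C X Y Z (k \<bullet> e) g"
proof -
  note t = kernel_arr[OF k] and e' = epic_arr[OF e]
  have ke: "\<guillemotleft>k \<bullet> e : X \<rightarrow> Y\<guillemotright>" using Comp_arr t e' by blast
  obtain Q q where q: "is_cokernel C X Y (k \<bullet> e) Q q" using ex_cokernel[OF ke] by blast
  note s = cokernel_arr[OF q]
  have "(q \<bullet> k) \<bullet> e = zero_arr X Q" using Comp_assoc[OF s(2) t(2) e'] s(3) by simp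
  then have qk: "q \<bullet> k = zero_arr K Q" using epic_cancel_zero[OF e Comp_arr[OF s(2) t(2)]] by blast
  have "is_kernel C Y Q q K k"
  proof (rule is_kernelI[OF s(2) kernel_monic[OF k] qk])
    have "g \<bullet> (k \<bullet> e) = zero_arr X Z"
      using Comp_assoc[OF t(1,2) e'] t(3) Comp_zero_left[OF e'] arr_Obj[OF t(1)] by simp
    then obtain g' where g': "\<guillemotleft>g' : Q \<rightarrow> Z\<guillemotright>" "g' \<bullet> q = g" using cokernel_lift[OF q t(1)] by blast
    fix W a assume a: "\<guillemotleft>a : W \<rightarrow> Y\<guillemotright>" "q \<bullet> a = zero_arr W Q"
    have "g \<bullet> a = zero_arr W Z"
      using Comp_assoc[OF g'(1) s(2) a(1)] g'(2) a(2) Comp_zero_right[OF g'(1)] arr_Obj[OF a(1)] by simp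
    then show "\<exists>u. \<guillemotleft>u : W \<rightarrow> K\<guillemotright> \<and> k \<bullet> u = a" using kernel_lift[OF k a(1)] by metis
  qed
  then show ?thesis using q k ke t(1) unfolding exact_at_def is_image_def by blast
qed

text \<open>The cross terms vanish as a consequence of the other identities: expanding p = p(ip +
  jq) gives p = p + (pj)q, hence (pj)q = 0, and composing with j gives pj = 0. The other identity is
  symmetric.\<close>

lemma biproduct_zero:
  assumes b: "is_biproduct C X Y S i j p q"
  shows "p \<bullet> j = zero_arr Y X" "q \<bullet> i = zero_arr X Y"
proof -
  have t: "\<guillemotleft>i : X \<rightarrow> S\<guillemotright>" "\<guillemotleft>j : Y \<rightarrow> S\<guillemotright>" "\<guillemotleft>p : S \<rightarrow> X\<guillemotright>" "\<guillemotleft>q : S \<rightarrow> Y\<guillemotright>"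
    and e: "p \<bullet> i = Ident C X" "q \<bullet> j = Ident C Y"
      "(i \<bullet> p) \<otimes>\<^bsub>Hom C S S\<^esub> (j \<bullet> q) = Ident C S"
    using b by (auto simp: is_biproduct_def)
  note obj = arr_Obj[OF t(1)] arr_Obj[OF t(2)]
  have ip: "\<guillemotleft>i \<bullet> p : S \<rightarrow> S\<guillemotright>" "\<guillemotleft>j \<bullet> q : S \<rightarrow> S\<guillemotright>" using Comp_arr t by blast+
  interpret SX: group "Hom C S X" using Hom_group obj by blast
  interpret SY: group "Hom C S Y" using Hom_group obj by blast
  have pj: "\<guillemotleft>p \<bullet> j : Y \<rightarrow> X\<guillemotright>" "\<guillemotleft>q \<bullet> i : X \<rightarrow> Y\<guillemotright>" using Comp_arr t by blast+
  have pjq: "\<guillemotleft>(p \<bullet> j) \<bullet> q : S \<rightarrow> X\<guillemotright>" "\<guillemotleft>(q \<bullet> i) \<bullet> p : S \<rightarrow> Y\<guillemotright>" using Comp_arr t pj by blast+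
  have "p \<otimes>\<^bsub>Hom C S X\<^esub> ((p \<bullet> j) \<bullet> q) = p"
    using Comp_add_right[OF t(3) ip] e Comp_Ident_right[OF t(3)]
      Comp_assoc[OF t(3,1,3)] Comp_assoc[OF t(3,2,4)] Comp_Ident_left[OF t(3)] by simp
  then have "(p \<bullet> j) \<bullet> q = zero_arr S X" using t(3) pjq by (simp add: arr_def)
  then have "(p \<bullet> j) \<bullet> (q \<bullet> j) = zero_arr Y X"
    using Comp_assoc[OF pj(1) t(4,2)] Comp_zero_left[OF t(2)] obj by simp
  then show "p \<bullet> j = zero_arr Y X" using e Comp_Ident_right[OF pj(1)] by simp
  have "((q \<bullet> i) \<bullet> p) \<otimes>\<^bsub>Hom C S Y\<^esub> q = q"
    using Comp_add_right[OF t(4) ip] e Comp_Ident_right[OF t(4)]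
      Comp_assoc[OF t(4,1,3)] Comp_assoc[OF t(4,2,4)] Comp_Ident_left[OF t(4)] by simp
  then have "(q \<bullet> i) \<bullet> p = zero_arr S Y" using t(4) pjq by (simp add: arr_def)
  then have "(q \<bullet> i) \<bullet> (p \<bullet> i) = zero_arr X Y"
    using Comp_assoc[OF pj(2) t(3,1)] Comp_zero_left[OF t(1)] obj by simp
  then show "q \<bullet> i = zero_arr X Y" using e Comp_Ident_right[OF pj(2)] by simp
qed

lemma ex_pullback_epic:
  assumes f: "is_epic C X Z f" and g: "\<guillemotleft>g : Y \<rightarrow> Z\<guillemotright>"
  obtains P p q where "is_pullback X Y Z f g P p q" "is_epic C P Y q"
proof -
  note f' = epic_arr[OF f]
  obtain S i j p q where b: "is_biproduct C X Y S i j p q"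
    using ex_biproduct arr_Obj f' g by meson
  have t: "\<guillemotleft>i : X \<rightarrow> S\<guillemotright>" "\<guillemotleft>j : Y \<rightarrow> S\<guillemotright>" "\<guillemotleft>p : S \<rightarrow> X\<guillemotright>" "\<guillemotleft>q : S \<rightarrow> Y\<guillemotright>"
    and e: "p \<bullet> i = Ident C X" "q \<bullet> j = Ident C Y"
      "(i \<bullet> p) \<otimes>\<^bsub>Hom C S S\<^esub> (j \<bullet> q) = Ident C S"
    using b by (auto simp: is_biproduct_def)
  note z = biproduct_zero[OF b]
  have obj: "X \<in> Obj C" "Y \<in> Obj C" "S \<in> Obj C" "Z \<in> Obj C" using arr_Obj t f' by blast+
  have fp: "\<guillemotleft>f \<bullet> p : S \<rightarrow> Z\<guillemotright>" "\<guillemotleft>g \<bullet> q : S \<rightarrow> Z\<guillemotright>" using Comp_arr f' g t by blast+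
  \<comment> \<open>The pullback is the kernel of fp - gq on the biproduct of X and Y. This arrow is
    epic because it restricts to the epic \<open>f\<close> on X.\<close>
  define \<pi> where "\<pi> = diff S Z (f \<bullet> p) (g \<bullet> q)"
  have \<pi>: "\<guillemotleft>\<pi> : S \<rightarrow> Z\<guillemotright>" using diff_arr fp \<pi>_def by simp
  have \<pi>_Comp: "\<pi> \<bullet> u = diff W Z (f \<bullet> (p \<bullet> u)) (g \<bullet> (q \<bullet> u))" if "\<guillemotleft>u : W \<rightarrow> S\<guillemotright>" for W u
    using Comp_diff_left[OF that fp] Comp_assoc[OF f' t(3) that] Comp_assoc[OF g t(4) that] \<pi>_def by simp
  have \<pi>i: "\<pi> \<bullet> i = f"
    using \<pi>_Comp[OF t(1)] e z Comp_Ident_right[OF f'] Comp_zero_right[OF g] obj diff_zero_right[OF f'] by simp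
  have "is_epic C S Z \<pi>"
  proof (rule is_epicI[OF \<pi>])
    fix W w assume w: "\<guillemotleft>w : Z \<rightarrow> W\<guillemotright>" "w \<bullet> \<pi> = zero_arr S W"
    have "w \<bullet> f = zero_arr X W"
      using Comp_assoc[OF w(1) \<pi> t(1)] w(2) \<pi>i Comp_zero_left[OF t(1)] arr_Obj[OF w(1)] by simp
    then show "w = zero_arr Z W" using epic_cancel_zero[OF f w(1)] by blast
  qed
  moreover obtain P m where m: "is_kernel C S Z \<pi> P m" using ex_kernel[OF \<pi>] by blast
  ultimately have ext: "is_extension P S Z m \<pi>" by (simp add: is_extension_def)
  note s = kernel_arr[OF m]
  have pm: "\<guillemotleft>p \<bullet> m : P \<rightarrow> X\<guillemotright>" "\<guillemotleft>q \<bullet> m : P \<rightarrow> Y\<guillemotright>" using Comp_arr t s by blast+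
  have comm: "f \<bullet> (p \<bullet> m) = g \<bullet> (q \<bullet> m)"
    using \<pi>_Comp[OF s(2)] s(3) diff_eq_zero_iff[OF Comp_arr[OF f' pm(1)] Comp_arr[OF g pm(2)]] by simp
  have decomp: "u = (i \<bullet> (p \<bullet> u)) \<otimes>\<^bsub>Hom C W S\<^esub> (j \<bullet> (q \<bullet> u))" if u: "\<guillemotleft>u : W \<rightarrow> S\<guillemotright>" for W u
    using Comp_add_left[OF Comp_arr[OF t(1,3)] Comp_arr[OF t(2,4)] u] e
      Comp_assoc[OF t(1,3) u] Comp_assoc[OF t(2,4) u] Comp_Ident_left[OF u] by simp
  have "is_pullback X Y Z f g P (p \<bullet> m) (q \<bullet> m)"
    unfolding is_pullback_def
  proof (intro conjI allI impI f' g pm comm)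
    fix W a b
    assume a: "\<guillemotleft>a : W \<rightarrow> X\<guillemotright>" and b: "\<guillemotleft>b : W \<rightarrow> Y\<guillemotright>" and ab: "f \<bullet> a = g \<bullet> b"
    have W: "W \<in> Obj C" using arr_Obj a by blast
    define u where "u = (i \<bullet> a) \<otimes>\<^bsub>Hom C W S\<^esub> (j \<bullet> b)"
    have ia: "\<guillemotleft>i \<bullet> a : W \<rightarrow> S\<guillemotright>" "\<guillemotleft>j \<bullet> b : W \<rightarrow> S\<guillemotright>" using Comp_arr t a b by blast+
    interpret WS: group "Hom C W S" using Hom_group obj W by blast
    interpret WX: group "Hom C W X" using Hom_group obj W by blast
    interpret WY: group "Hom C W Y" using Hom_group obj W by blast
    have u: "\<guillemotleft>u : W \<rightarrow> S\<guillemotright>" using ia by (simp add: u_def arr_def)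
    have "p \<bullet> (i \<bullet> a) = a" "p \<bullet> (j \<bullet> b) = zero_arr W X"
      using Comp_assoc[OF t(3,1) a] Comp_assoc[OF t(3,2) b] e z
        Comp_Ident_left[OF a] Comp_zero_left[OF b obj(1)] by auto
    then have pu: "p \<bullet> u = a"
      using Comp_add_right[OF t(3) ia] a by (simp add: u_def arr_def)
    have "q \<bullet> (i \<bullet> a) = zero_arr W Y" "q \<bullet> (j \<bullet> b) = b"
      using Comp_assoc[OF t(4,1) a] Comp_assoc[OF t(4,2) b] e z
        Comp_Ident_left[OF b] Comp_zero_left[OF a obj(2)] by auto
    then have qu: "q \<bullet> u = b"
      using Comp_add_right[OF t(4) ia] b by (simp add: u_def arr_def)
    have "\<pi> \<bullet> u = zero_arr W Z"
      using \<pi>_Comp[OF u] pu qu ab diff_eq_zero_iff[OF Comp_arr[OF f' a] Comp_arr[OF g b]] by simp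
    then obtain v where v: "\<guillemotleft>v : W \<rightarrow> P\<guillemotright>" "m \<bullet> v = u" using kernel_lift[OF m u] by blast
    show "\<exists>!v. \<guillemotleft>v : W \<rightarrow> P\<guillemotright> \<and> (p \<bullet> m) \<bullet> v = a \<and> (q \<bullet> m) \<bullet> v = b"
    proof (rule ex1I[of _ v])
      show "\<guillemotleft>v : W \<rightarrow> P\<guillemotright> \<and> (p \<bullet> m) \<bullet> v = a \<and> (q \<bullet> m) \<bullet> v = b"
        using v pu qu Comp_assoc[OF t(3) s(2) v(1)] Comp_assoc[OF t(4) s(2) v(1)] by simp
      fix v' assume v': "\<guillemotleft>v' : W \<rightarrow> P\<guillemotright> \<and> (p \<bullet> m) \<bullet> v' = a \<and> (q \<bullet> m) \<bullet> v' = b"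
      then have v'': "\<guillemotleft>v' : W \<rightarrow> P\<guillemotright>" "p \<bullet> (m \<bullet> v') = a" "q \<bullet> (m \<bullet> v') = b"
        using Comp_assoc[OF t(3) s(2)] Comp_assoc[OF t(4) s(2)] by metis+
      have "m \<bullet> v' = u" using decomp[OF Comp_arr[OF s(2) v''(1)]] v'' u_def by simp
      then show "v' = v" using kernel_cancel[OF m v''(1) v(1)] v(2) by simp
    qed
  qed
  moreover have "is_epic C P Y (q \<bullet> m)"
  proof (rule is_epicI[OF pm(2)])
    fix W w assume w: "\<guillemotleft>w : Y \<rightarrow> W\<guillemotright>" "w \<bullet> (q \<bullet> m) = zero_arr P W"
    have W: "W \<in> Obj C" using arr_Obj w by blast
    have wq: "\<guillemotleft>w \<bullet> q : S \<rightarrow> W\<guillemotright>" using Comp_arr w t by blast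
    have "(w \<bullet> q) \<bullet> m = zero_arr P W" using Comp_assoc[OF w(1) t(4) s(2)] w(2) by simp
    \<comment> \<open>The arrow \<open>w \<bullet> q\<close> vanishes on the kernel of
      \<open>\<pi>\<close> and so factors as \<open>v \<bullet> \<pi>\<close>. Restriction to X
      shows that \<open>v\<close> kills \<open>f\<close>, hence is zero; restriction to Y then shows
      that \<open>w\<close> is zero.\<close>
    then obtain v where v: "\<guillemotleft>v : Z \<rightarrow> W\<guillemotright>" "v \<bullet> \<pi> = w \<bullet> q" using extension_descend[OF ext wq] by blast
    have "v \<bullet> f = (w \<bullet> q) \<bullet> i" using v(2) \<pi>i Comp_assoc[OF v(1) \<pi> t(1)] by simp
    also have "\<dots> = zero_arr X W"
      using Comp_assoc[OF w(1) t(4,1)] z Comp_zero_right[OF w(1)] obj by simp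
    finally have "v = zero_arr Z W" using epic_cancel_zero[OF f v(1)] by blast
    then have "w \<bullet> q = zero_arr S W" using v(2) Comp_zero_left[OF \<pi> W] by simp
    then have "w \<bullet> (q \<bullet> j) = zero_arr Y W"
      using Comp_assoc[OF w(1) t(4,2)] Comp_zero_left[OF t(2) W] by simp
    then show "w = zero_arr Y W" using e Comp_Ident_right[OF w(1)] by simp
  qed
  ultimately show thesis using that by blast
qed

text \<open>Some pullback of \<open>f\<close> along \<open>g\<close> has an epic projection onto Y,
  and that projection factors through \<open>q\<close>.\<close>

lemma pullback_epic:
  assumes pb: "is_pullback X Y Z f g P p q" and f: "is_epic C X Z f"
  shows "is_epic C P Y q"
proof -
  note t = pullback_arr[OF pb]
  obtain P' p' q' where pb': "is_pullback X Y Z f g P' p' q'" and q': "is_epic C P' Y q'"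
    using ex_pullback_epic[OF f t(2)] by blast
  note s = pullback_arr[OF pb']
  obtain u where u: "\<guillemotleft>u : P' \<rightarrow> P\<guillemotright>" "q \<bullet> u = q'" using pullback_lift[OF pb s(3,4,5)] by metis
  show ?thesis
  proof (rule is_epicI[OF t(4)])
    fix W w assume w: "\<guillemotleft>w : Y \<rightarrow> W\<guillemotright>" "w \<bullet> q = zero_arr P W"
    have "w \<bullet> q' = zero_arr P' W"
      using Comp_assoc[OF w(1) t(4) u(1)] u(2) w(2) Comp_zero_left[OF u(1)] arr_Obj[OF w(1)] by simp
    then show "w = zero_arr Y W" using epic_cancel_zero[OF q' w(1)] by blast
  qed
qed

lemma pullback_extension:
  assumes pb: "is_pullback X Y Z f g P p q" and ext: "is_extension K X Z k f"
  obtains k' where "is_extension K P Y k' q" "p \<bullet> k' = k"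
  using pullback_kernel[OF pb] pullback_epic[OF pb] ext unfolding is_extension_def by metis

lemma ex_extension:
  assumes "is_epic C M X e"
  obtains K k where "is_extension K M X k e"
  using ex_kernel[OF epic_arr[OF assms]] assms unfolding is_extension_def by blast

lemma extension_arr:
  assumes "is_extension K M X k e"
  shows "\<guillemotleft>k : K \<rightarrow> M\<guillemotright>" "\<guillemotleft>e : M \<rightarrow> X\<guillemotright>" "e \<bullet> k = zero_arr K X"
    "is_kernel C M X e K k" "is_epic C M X e"
  using assms kernel_arr unfolding is_extension_def by blast+

section \<open>Splittings and zero objects\<close>

text \<open>Projectivity gives a section \<open>s\<close>. The endomorphism 1 - sq is killed by
  \<open>q\<close>, hence factors through the kernel, and the factor is the retraction
  \<open>r\<close>.\<close>

lemma extension_split: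
  assumes ext: "is_extension K M P k q" and P: "is_projective C P"
  obtains r s where "\<guillemotleft>r : M \<rightarrow> K\<guillemotright>" "r \<bullet> k = Ident C K" "\<guillemotleft>s : P \<rightarrow> M\<guillemotright>" "q \<bullet> s = Ident C P"
proof -
  note t = extension_arr[OF ext]
  have obj: "K \<in> Obj C" "M \<in> Obj C" "P \<in> Obj C" using arr_Obj t by blast+
  obtain s where s: "\<guillemotleft>s : P \<rightarrow> M\<guillemotright>" "q \<bullet> s = Ident C P"
    using P t(5) Ident_arr[OF obj(3)] unfolding is_projective_def by blast
  note sq = Comp_arr[OF s(1) t(2)] and iM = Ident_arr[OF obj(2)]
  have d: "\<guillemotleft>diff M M (Ident C M) (s \<bullet> q) : M \<rightarrow> M\<guillemotright>" using diff_arr[OF iM sq] .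
  have "q \<bullet> (s \<bullet> q) = q"
    using Comp_assoc[OF t(2) s(1) t(2)] s(2) Comp_Ident_left[OF t(2)] by simp
  then have "q \<bullet> diff M M (Ident C M) (s \<bullet> q) = zero_arr M P"
    using Comp_diff_right[OF t(2) iM sq] Comp_Ident_right[OF t(2)] diff_eq_zero_iff[OF t(2,2)] by simp
  then obtain r where r: "\<guillemotleft>r : M \<rightarrow> K\<guillemotright>" "k \<bullet> r = diff M M (Ident C M) (s \<bullet> q)"
    using kernel_lift[OF t(4) d] by blast
  have "k \<bullet> (r \<bullet> k) = diff M M (Ident C M) (s \<bullet> q) \<bullet> k" using Comp_assoc[OF t(1) r(1) t(1)] r(2) by simp
  also have "\<dots> = diff K M k (zero_arr K M)"
    using Comp_diff_left[OF t(1) iM sq] Comp_Ident_left[OF t(1)] Comp_assoc[OF s(1) t(2,1)] t(3)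
      Comp_zero_right[OF s(1)] obj by simp
  also have "\<dots> = k \<bullet> Ident C K" using diff_zero_right[OF t(1)] Comp_Ident_right[OF t(1)] by simp
  finally have "r \<bullet> k = Ident C K"
    using kernel_cancel[OF t(4) Comp_arr[OF r(1) t(1)] Ident_arr[OF obj(1)]] by blast
  then show thesis using that r s by blast
qed

text \<open>With a zero kernel, the identity of M kills \<open>l\<close> and descends along
  \<open>e\<close> to an inverse of \<open>e\<close>. Vanishing of L is expressed by its identity, a
  form that passes to quotients of zero objects by cancelling an epic.\<close>

lemma extension_by_zero_split:
  assumes ext: "is_extension L M X l e" and L: "Ident C L = zero_arr L L"
  obtains s where "\<guillemotleft>s : X \<rightarrow> M\<guillemotright>" "e \<bullet> s = Ident C X"
proof -
  note t = extension_arr[OF ext]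
  have obj: "L \<in> Obj C" "M \<in> Obj C" "X \<in> Obj C" using arr_Obj t by blast+
  have "Ident C M \<bullet> l = zero_arr L M"
    using Comp_Ident_left[OF t(1)] Comp_Ident_right[OF t(1)] L Comp_zero_right[OF t(1) obj(1)] by simp
  then obtain s where s: "\<guillemotleft>s : X \<rightarrow> M\<guillemotright>" "s \<bullet> e = Ident C M"
    using extension_descend[OF ext Ident_arr[OF obj(2)]] by blast
  have "(e \<bullet> s) \<bullet> e = Ident C X \<bullet> e"
    using Comp_assoc[OF t(2) s(1) t(2)] s(2) Comp_Ident_right[OF t(2)] Comp_Ident_left[OF t(2)] by simp
  then have "e \<bullet> s = Ident C X"
    using epic_cancel[OF t(5) Comp_arr[OF t(2) s(1)] Ident_arr[OF obj(3)]] by blast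
  then show thesis using that s by blast
qed

lemma zero_object_arr_unique:
  assumes "is_zero_object C Z"
  shows "\<lbrakk>\<guillemotleft>f : X \<rightarrow> Z\<guillemotright>; \<guillemotleft>g : X \<rightarrow> Z\<guillemotright>\<rbrakk> \<Longrightarrow> f = g" "\<lbrakk>\<guillemotleft>f : Z \<rightarrow> X\<guillemotright>; \<guillemotleft>g : Z \<rightarrow> X\<guillemotright>\<rbrakk> \<Longrightarrow> f = g"
  using assms arr_Obj unfolding is_zero_object_def by blast+

lemma kernel_of_monic:
  assumes m: "is_monic C X Y m" and Z: "is_zero_object C Z"
  shows "is_kernel C X Y m Z (zero_arr Z X)"
proof (rule is_kernelI)
  show t: "\<guillemotleft>m : X \<rightarrow> Y\<guillemotright>" using m by (simp add: is_monic_def)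
  note obj = arr_Obj[OF t]
  have Z': "Z \<in> Obj C" using Z by (simp add: is_zero_object_def)
  show "m \<bullet> zero_arr Z X = zero_arr Z Y" using Comp_zero_right[OF t Z'] .
  show "is_monic C Z X (zero_arr Z X)"
    unfolding is_monic_def using zero_arr_arr[OF Z' obj(1)] zero_object_arr_unique(1)[OF Z] by blast
  fix W g assume g: "\<guillemotleft>g : W \<rightarrow> X\<guillemotright>" "m \<bullet> g = zero_arr W Y"
  have W: "W \<in> Obj C" using arr_Obj g by blast
  have "m \<bullet> g = m \<bullet> zero_arr W X" using g(2) Comp_zero_right[OF t W] by simp
  then have "g = zero_arr W X" using m g(1) zero_arr_arr[OF W obj(1)] unfolding is_monic_def by blast
  then show "\<exists>u. \<guillemotleft>u : W \<rightarrow> Z\<guillemotright> \<and> zero_arr Z X \<bullet> u = g"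
    using zero_arr_arr[OF W Z'] Comp_zero_right[OF zero_arr_arr[OF Z' obj(1)] W] by blast
qed

lemma kernel_to_zero_object:
  assumes t: "\<guillemotleft>z : X \<rightarrow> Z\<guillemotright>" and Z: "is_zero_object C Z"
  shows "is_kernel C X Z z X (Ident C X)"
proof (rule is_kernelI[OF t])
  have X: "X \<in> Obj C" using arr_Obj t by blast
  show "is_monic C X X (Ident C X)" unfolding is_monic_def using Ident_arr[OF X] Comp_Ident_left by metis
  show "z \<bullet> Ident C X = zero_arr X Z"
    using Comp_arr[OF t Ident_arr[OF X]] zero_arr_arr arr_Obj[OF t] zero_object_arr_unique(1)[OF Z] by blast
  fix W g assume "\<guillemotleft>g : W \<rightarrow> X\<guillemotright>"
  then show "\<exists>u. \<guillemotleft>u : W \<rightarrow> X\<guillemotright> \<and> Ident C X \<bullet> u = g" using Comp_Ident_left by blast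
qed

end

section \<open>Vanishing of Ext\<close>

context abelian_category
begin

text \<open>By the long exact sequence this says that \<open>Ext 1 X Y\<close> vanishes, without reference to
  a projective resolution.\<close>

definition ext1_zero :: "'o \<Rightarrow> 'o \<Rightarrow> bool"
  where "ext1_zero X Y \<longleftrightarrow> (\<forall>K M k e. is_extension K M X k e \<longrightarrow>
    (\<forall>g. \<guillemotleft>g : K \<rightarrow> Y\<guillemotright> \<longrightarrow> (\<exists>h. \<guillemotleft>h : M \<rightarrow> Y\<guillemotright> \<and> h \<bullet> k = g)))"

lemma ext1_zero_extend:
  assumes "ext1_zero X Y" "is_extension K M X k e" "\<guillemotleft>g : K \<rightarrow> Y\<guillemotright>"
  obtains h where "\<guillemotleft>h : M \<rightarrow> Y\<guillemotright>" "h \<bullet> k = g"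
  using assms unfolding ext1_zero_def by blast

lemma ext1_zero_projective:
  assumes "is_projective C P"
  shows "ext1_zero P Y"
  unfolding ext1_zero_def
proof (intro allI impI)
  fix K M k e g assume ext: "is_extension K M P k e" and g: "\<guillemotleft>g : K \<rightarrow> Y\<guillemotright>"
  obtain r where r: "\<guillemotleft>r : M \<rightarrow> K\<guillemotright>" "r \<bullet> k = Ident C K" using extension_split[OF ext assms] by blast
  have "(g \<bullet> r) \<bullet> k = g"
    using Comp_assoc[OF g r(1) extension_arr(1)[OF ext]] r(2) Comp_Ident_right[OF g] by simp
  then show "\<exists>h. \<guillemotleft>h : M \<rightarrow> Y\<guillemotright> \<and> h \<bullet> k = g" using Comp_arr[OF g r(1)] by blast
qed

text \<open>The arrow on K is extended in two stages. The preimage U of X in M is an extension of X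
  by K, and M is an extension of Z by U.\<close>

lemma ext1_zero_extension:
  assumes V: "is_extension X V Z i e" and X: "ext1_zero X Y" and Z: "ext1_zero Z Y"
  shows "ext1_zero V Y"
  unfolding ext1_zero_def
proof (intro allI impI)
  fix K M k c g assume ext: "is_extension K M V k c" and g: "\<guillemotleft>g : K \<rightarrow> Y\<guillemotright>"
  note t = extension_arr[OF ext] and s = extension_arr[OF V]
  obtain U p q where pb: "is_pullback M X V c i U p q" using ex_pullback_epic[OF t(5) s(1)] by blast
  obtain k' where k': "is_extension K U X k' q" "p \<bullet> k' = k" using pullback_extension[OF pb ext] by blast
  obtain f where f: "\<guillemotleft>f : U \<rightarrow> Y\<guillemotright>" "f \<bullet> k' = g" using ext1_zero_extend[OF X k'(1) g] by blast
  have "is_extension U M Z p (e \<bullet> c)"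
    using pullback_of_kernel[OF pb s(4)] epic_Comp[OF t(5) s(5)] by (simp add: is_extension_def)
  then obtain h where h: "\<guillemotleft>h : M \<rightarrow> Y\<guillemotright>" "h \<bullet> p = f" using ext1_zero_extend[OF Z _ f(1)] by blast
  have "h \<bullet> k = g"
    using Comp_assoc[OF h(1) pullback_arr(3)[OF pb] extension_arr(1)[OF k'(1)]] h(2) f(2) k'(2) by simp
  then show "\<exists>h. \<guillemotleft>h : M \<rightarrow> Y\<guillemotright> \<and> h \<bullet> k = g" using h(1) by blast
qed

text \<open>A single projective presentation of X tests all extensions of X. The pullback U of P and
  M over X contains both K and L: over P it splits, which gives a first extension of
  \<open>g\<close> to U, and over M it allows a corrected version to descend.\<close>

lemma ext1_zero_projective_presentation:
  assumes ext: "is_extension K P X k e" and P: "is_projective C P"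
  shows "ext1_zero X Y \<longleftrightarrow> (\<forall>g. \<guillemotleft>g : K \<rightarrow> Y\<guillemotright> \<longrightarrow> (\<exists>h. \<guillemotleft>h : P \<rightarrow> Y\<guillemotright> \<and> h \<bullet> k = g))"
proof
  assume "ext1_zero X Y"
  then show "\<forall>g. \<guillemotleft>g : K \<rightarrow> Y\<guillemotright> \<longrightarrow> (\<exists>h. \<guillemotleft>h : P \<rightarrow> Y\<guillemotright> \<and> h \<bullet> k = g)"
    using ext unfolding ext1_zero_def by blast
next
  assume hyp: "\<forall>g. \<guillemotleft>g : K \<rightarrow> Y\<guillemotright> \<longrightarrow> (\<exists>h. \<guillemotleft>h : P \<rightarrow> Y\<guillemotright> \<and> h \<bullet> k = g)"
  show "ext1_zero X Y"
    unfolding ext1_zero_def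
  proof (intro allI impI)
    fix L M l c g assume ext': "is_extension L M X l c" and g: "\<guillemotleft>g : L \<rightarrow> Y\<guillemotright>"
    note t = extension_arr[OF ext] and s = extension_arr[OF ext']
    obtain U p q where pb: "is_pullback P M X e c U p q" using ex_pullback_epic[OF t(5) s(2)] by blast
    note pq = pullback_arr[OF pb]
    obtain k' where k': "is_extension K U M k' q" "p \<bullet> k' = k" using pullback_extension[OF pb ext] by blast
    obtain l' where l': "is_extension L U P l' p" "q \<bullet> l' = l"
      using pullback_extension[OF is_pullback_sym[OF pb] ext'] by blast
    note k'_arr = extension_arr(1,3)[OF k'(1)] and l'_arr = extension_arr(1,3)[OF l'(1)]
    obtain r where r: "\<guillemotleft>r : U \<rightarrow> L\<guillemotright>" "r \<bullet> l' = Ident C L" using extension_split[OF l'(1) P] by blast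
    have gr: "\<guillemotleft>g \<bullet> r : U \<rightarrow> Y\<guillemotright>" using Comp_arr g r by blast
    obtain f where f: "\<guillemotleft>f : P \<rightarrow> Y\<guillemotright>" "f \<bullet> k = (g \<bullet> r) \<bullet> k'" using hyp Comp_arr[OF gr k'_arr(1)] by blast
    have fp: "\<guillemotleft>f \<bullet> p : U \<rightarrow> Y\<guillemotright>" using Comp_arr f pq by blast
    \<comment> \<open>Subtracting \<open>f \<bullet> p\<close> makes \<open>g \<bullet> r\<close>
      vanish on K without changing its restriction to L, because \<open>p\<close> kills L. The
      difference therefore descends to M and still extends \<open>g\<close>.\<close>
    have d: "\<guillemotleft>diff U Y (g \<bullet> r) (f \<bullet> p) : U \<rightarrow> Y\<guillemotright>" using diff_arr gr fp by blast
    have "(f \<bullet> p) \<bullet> k' = (g \<bullet> r) \<bullet> k'" using Comp_assoc[OF f(1) pq(3) k'_arr(1)] k'(2) f(2) by simp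
    then have "diff U Y (g \<bullet> r) (f \<bullet> p) \<bullet> k' = zero_arr K Y"
      using Comp_diff_left[OF k'_arr(1) gr fp] diff_eq_zero_iff Comp_arr[OF gr k'_arr(1)] by simp
    then obtain h where h: "\<guillemotleft>h : M \<rightarrow> Y\<guillemotright>" "h \<bullet> q = diff U Y (g \<bullet> r) (f \<bullet> p)"
      using extension_descend[OF k'(1) d] by blast
    have "h \<bullet> l = diff U Y (g \<bullet> r) (f \<bullet> p) \<bullet> l'" using Comp_assoc[OF h(1) pq(4) l'_arr(1)] h(2) l'(2) by simp
    also have "\<dots> = diff L Y ((g \<bullet> r) \<bullet> l') ((f \<bullet> p) \<bullet> l')" using Comp_diff_left[OF l'_arr(1) gr fp] .
    also have "(g \<bullet> r) \<bullet> l' = g" using Comp_assoc[OF g r(1) l'_arr(1)] r(2) Comp_Ident_right[OF g] by simp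
    also have "(f \<bullet> p) \<bullet> l' = zero_arr L Y"
      using Comp_assoc[OF f(1) pq(3) l'_arr(1)] l'_arr(2) Comp_zero_right[OF f(1)] arr_Obj[OF g] by simp
    also have "diff L Y g (zero_arr L Y) = g" using diff_zero_right[OF g] .
    finally show "\<exists>h. \<guillemotleft>h : M \<rightarrow> Y\<guillemotright> \<and> h \<bullet> l = g" using h(1) by blast
  qed
qed

text \<open>The extension is pulled back along \<open>r\<close> to an extension U of A, where the
  arrow extends. Since \<open>r \<bullet> i\<close> is the identity, M maps back to U over
  \<open>i\<close>, and this map is the identity on K.\<close>

lemma ext1_zero_retract:
  assumes A: "ext1_zero A Y" and i: "\<guillemotleft>i : X \<rightarrow> A\<guillemotright>" and r: "\<guillemotleft>r : A \<rightarrow> X\<guillemotright>" "r \<bullet> i = Ident C X"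
  shows "ext1_zero X Y"
  unfolding ext1_zero_def
proof (intro allI impI)
  fix K M k c g assume ext: "is_extension K M X k c" and g: "\<guillemotleft>g : K \<rightarrow> Y\<guillemotright>"
  note t = extension_arr[OF ext]
  have obj: "M \<in> Obj C" "K \<in> Obj C" using arr_Obj t(1) by blast+
  obtain U p q where pb: "is_pullback M A X c r U p q" using ex_pullback_epic[OF t(5) r(1)] by blast
  note pq = pullback_arr[OF pb]
  obtain k' where k': "is_extension K U A k' q" "p \<bullet> k' = k" using pullback_extension[OF pb ext] by blast
  note s = extension_arr[OF k'(1)]
  obtain f where f: "\<guillemotleft>f : U \<rightarrow> Y\<guillemotright>" "f \<bullet> k' = g" using ext1_zero_extend[OF A k'(1) g] by blast
  have ic: "\<guillemotleft>i \<bullet> c : M \<rightarrow> A\<guillemotright>" using Comp_arr i t by blast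
  have "c \<bullet> Ident C M = r \<bullet> (i \<bullet> c)"
    using Comp_assoc[OF r(1) i t(2)] r(2) Comp_Ident_left[OF t(2)] Comp_Ident_right[OF t(2)] by simp
  then obtain u where u: "\<guillemotleft>u : M \<rightarrow> U\<guillemotright>" "p \<bullet> u = Ident C M" "q \<bullet> u = i \<bullet> c"
    using pullback_lift[OF pb Ident_arr[OF obj(1)] ic] by metis
  have "p \<bullet> (u \<bullet> k) = p \<bullet> k'"
    using Comp_assoc[OF pq(3) u(1) t(1)] u(2) k'(2) Comp_Ident_left[OF t(1)] by simp
  moreover have "q \<bullet> (u \<bullet> k) = q \<bullet> k'"
    using Comp_assoc[OF pq(4) u(1) t(1)] u(3) Comp_assoc[OF i t(2,1)] t(3) s(3)
      Comp_zero_right[OF i obj(2)] by simp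
  ultimately have "u \<bullet> k = k'" using pullback_cancel[OF pb Comp_arr[OF u(1) t(1)] s(1)] by blast
  then have "(f \<bullet> u) \<bullet> k = g" using Comp_assoc[OF f(1) u(1) t(1)] f(2) by simp
  then show "\<exists>h. \<guillemotleft>h : M \<rightarrow> Y\<guillemotright> \<and> h \<bullet> k = g" using Comp_arr[OF f(1) u(1)] by blast
qed

section \<open>Comparison of \<open>Ext\<close> in degrees 1 and 2 with the extension
  property\<close>

text \<open>A quotient group is trivial exactly when the subgroup is everything, so the claim is
  that all cocycles are coboundaries. Writing the degree as \<open>Suc j\<close> puts
  \<open>coboundaries\<close> in the case where it is an image.\<close>

lemma trivial_cohomology_iff:
  assumes d: "\<guillemotleft>d j : P (Suc j) \<rightarrow> P j\<guillemotright>" and d': "\<guillemotleft>d (Suc j) : P (Suc (Suc j)) \<rightarrow> P (Suc j)\<guillemotright>"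
    and dd: "d j \<bullet> d (Suc j) = zero_arr (P (Suc (Suc j))) (P j)" and Y: "Y \<in> Obj C"
  shows "trivial_group (cohomology_of C P d Y (Suc j)) \<longleftrightarrow>
    (\<forall>\<phi>. \<guillemotleft>\<phi> : P (Suc j) \<rightarrow> Y\<guillemotright> \<longrightarrow> \<phi> \<bullet> d (Suc j) = zero_arr (P (Suc (Suc j))) Y \<longrightarrow>
      (\<exists>\<psi>. \<guillemotleft>\<psi> : P j \<rightarrow> Y\<guillemotright> \<and> \<psi> \<bullet> d j = \<phi>))"
proof -
  note obj = arr_Obj[OF d] arr_Obj[OF d']
  let ?G0 = "Hom C (P j) Y" and ?G1 = "Hom C (P (Suc j)) Y" and ?G2 = "Hom C (P (Suc (Suc j))) Y"
  let ?Z = "cocycles C P d Y (Suc j)" and ?B = "coboundaries C P d Y (Suc j)"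
  interpret G0: comm_group ?G0 using Hom_comm_group obj Y by blast
  interpret G1: comm_group ?G1 using Hom_comm_group obj Y by blast
  interpret G2: comm_group ?G2 using Hom_comm_group obj Y by blast
  have hom: "(\<lambda>\<phi>. \<phi> \<bullet> f) \<in> hom (Hom C U Y) (Hom C V Y)" if "\<guillemotleft>f : V \<rightarrow> U\<guillemotright>" for f U V
    using Comp_add_left[OF _ _ that] Comp_arr[OF _ that] arr_Obj[OF that] Y
    by (auto simp: hom_def arr_def)
  interpret h1: group_hom ?G0 ?G1 "\<lambda>\<phi>. \<phi> \<bullet> d j" by unfold_locales (rule hom[OF d])
  interpret h2: group_hom ?G1 ?G2 "\<lambda>\<phi>. \<phi> \<bullet> d (Suc j)" by unfold_locales (rule hom[OF d'])
  have Z: "subgroup ?Z ?G1" unfolding cocycles_def by (rule h2.subgroup_kernel)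
  have B: "subgroup ?B ?G1" unfolding coboundaries_def by (simp add: h1.img_is_subgroup)
  have mem_Z: "\<phi> \<in> ?Z \<longleftrightarrow> \<guillemotleft>\<phi> : P (Suc j) \<rightarrow> Y\<guillemotright> \<and> \<phi> \<bullet> d (Suc j) = zero_arr (P (Suc (Suc j))) Y" for \<phi>
    using obj Y by (auto simp: cocycles_def kernel_def arr_def)
  have mem_B: "\<phi> \<in> ?B \<longleftrightarrow> (\<exists>\<psi>. \<guillemotleft>\<psi> : P j \<rightarrow> Y\<guillemotright> \<and> \<psi> \<bullet> d j = \<phi>)" for \<phi>
    using obj Y by (auto simp: coboundaries_def arr_def)
  have BZ: "?B \<subseteq> ?Z"
  proof
    fix \<phi> assume "\<phi> \<in> ?B"
    then obtain \<psi> where \<psi>: "\<guillemotleft>\<psi> : P j \<rightarrow> Y\<guillemotright>" "\<psi> \<bullet> d j = \<phi>" using mem_B by blast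
    have "\<phi> \<bullet> d (Suc j) = zero_arr (P (Suc (Suc j))) Y"
      using Comp_assoc[OF \<psi>(1) d d'] dd \<psi>(2) Comp_zero_right[OF \<psi>(1)] obj by simp
    then show "\<phi> \<in> ?Z" using mem_Z Comp_arr[OF \<psi>(1) d] \<psi>(2) by simp
  qed
  have "comm_group (?G1\<lparr>carrier := ?Z\<rparr>)" 
    by (intro group.group_comm_groupI subgroup.subgroup_is_group[OF Z] G1.group_axioms)
      (use subgroup.subset[OF Z] G1.m_comm in auto)
  moreover have "subgroup ?B (?G1\<lparr>carrier := ?Z\<rparr>)" using G1.subgroup_incl B Z BZ by blast
  ultimately have "trivial_group (cohomology_of C P d Y (Suc j)) \<longleftrightarrow> ?B = ?Z"
    unfolding cohomology_of_def using trivial_group_Mod by fastforce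
  also have "\<dots> \<longleftrightarrow> ?Z \<subseteq> ?B" using BZ by blast
  finally show ?thesis using mem_Z mem_B by blast
qed

text \<open>Cocycles on P' are the arrows killing the image of \<open>a\<close>. By exactness and
  monicity of \<open>k\<close> this image is the kernel of \<open>e\<close>, so cocycles correspond
  to arrows out of the syzygy K. Being a coboundary means that the arrow on K extends along
  \<open>k\<close>.\<close>

lemma cocycles_factor_iff:
  assumes ex: "exact_at C P'' P' P a (k \<bullet> e)" and k: "is_monic C K P k" and e: "is_epic C P' K e"
  shows "(\<forall>\<phi>. \<guillemotleft>\<phi> : P' \<rightarrow> Y\<guillemotright> \<longrightarrow> \<phi> \<bullet> a = zero_arr P'' Y \<longrightarrow> (\<exists>\<psi>. \<guillemotleft>\<psi> : P \<rightarrow> Y\<guillemotright> \<and> \<psi> \<bullet> (k \<bullet> e) = \<phi>)) \<longleftrightarrow>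
    (\<forall>g. \<guillemotleft>g : K \<rightarrow> Y\<guillemotright> \<longrightarrow> (\<exists>h. \<guillemotleft>h : P \<rightarrow> Y\<guillemotright> \<and> h \<bullet> k = g))" (is "?L \<longleftrightarrow> ?R")
proof -
  have k': "\<guillemotleft>k : K \<rightarrow> P\<guillemotright>" using k by (simp add: is_monic_def)
  note e' = epic_arr[OF e]
  obtain I m where ext: "is_extension I P' K m e" using ex_extension[OF e] by blast
  note t = extension_arr[OF ext]
  obtain c where c: "is_epic C P'' I c" "a = m \<bullet> c"
    using exact_at_factor[OF ex kernel_Comp_monic[OF t(4) k]] by blast
  note c' = epic_arr[OF c(1)]
  have ea: "e \<bullet> a = zero_arr P'' K"
    using Comp_assoc[OF e' t(1) c'] c(2) t(3) Comp_zero_left[OF c'] arr_Obj[OF e'] by simp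
  have a: "\<guillemotleft>a : P'' \<rightarrow> P'\<guillemotright>" using Comp_arr[OF t(1) c'] c(2) by simp
  show ?thesis
  proof
    assume L: ?L
    show ?R
    proof (intro allI impI)
      fix g assume g: "\<guillemotleft>g : K \<rightarrow> Y\<guillemotright>"
      have "(g \<bullet> e) \<bullet> a = zero_arr P'' Y"
        using Comp_assoc[OF g e' a] ea Comp_zero_right[OF g] arr_Obj[OF a] by simp
      then obtain h where h: "\<guillemotleft>h : P \<rightarrow> Y\<guillemotright>" "h \<bullet> (k \<bullet> e) = g \<bullet> e" using L Comp_arr[OF g e'] by blast
      have "(h \<bullet> k) \<bullet> e = g \<bullet> e" using Comp_assoc[OF h(1) k' e'] h(2) by simp
      then have "h \<bullet> k = g" using epic_cancel[OF e Comp_arr[OF h(1) k'] g] by blast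
      then show "\<exists>h. \<guillemotleft>h : P \<rightarrow> Y\<guillemotright> \<and> h \<bullet> k = g" using h by blast
    qed
  next
    assume R: ?R
    show ?L
    proof (intro allI impI)
      fix \<phi> assume \<phi>: "\<guillemotleft>\<phi> : P' \<rightarrow> Y\<guillemotright>" "\<phi> \<bullet> a = zero_arr P'' Y"
      have "(\<phi> \<bullet> m) \<bullet> c = zero_arr P'' Y" using Comp_assoc[OF \<phi>(1) t(1) c'] \<phi>(2) c(2) by simp
      then have "\<phi> \<bullet> m = zero_arr I Y" using epic_cancel_zero[OF c(1) Comp_arr[OF \<phi>(1) t(1)]] by blast
      then obtain \<chi> where \<chi>: "\<guillemotleft>\<chi> : K \<rightarrow> Y\<guillemotright>" "\<chi> \<bullet> e = \<phi>" using extension_descend[OF ext \<phi>(1)] by blast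
      obtain h where h: "\<guillemotleft>h : P \<rightarrow> Y\<guillemotright>" "h \<bullet> k = \<chi>" using R \<chi>(1) by blast
      have "h \<bullet> (k \<bullet> e) = \<phi>" using Comp_assoc[OF h(1) k' e'] h(2) \<chi>(2) by simp
      then show "\<exists>\<psi>. \<guillemotleft>\<psi> : P \<rightarrow> Y\<guillemotright> \<and> \<psi> \<bullet> (k \<bullet> e) = \<phi>" using h(1) by blast
    qed
  qed
qed

lemma exact_at_Comp_zero:
  assumes "exact_at C X Y Z f g"
  shows "\<guillemotleft>f : X \<rightarrow> Y\<guillemotright>" "\<guillemotleft>g : Y \<rightarrow> Z\<guillemotright>" "g \<bullet> f = zero_arr X Z"
proof -
  show t: "\<guillemotleft>f : X \<rightarrow> Y\<guillemotright>" "\<guillemotleft>g : Y \<rightarrow> Z\<guillemotright>" using assms by (auto simp: exact_at_def)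
  obtain K k where k: "is_kernel C Y Z g K k" using ex_kernel[OF t(2)] by blast
  obtain e where e: "is_epic C X K e" "f = k \<bullet> e" using exact_at_factor[OF assms k] by blast
  note e' = epic_arr[OF e(1)]
  show "g \<bullet> f = zero_arr X Z"
    using Comp_assoc[OF t(2) kernel_arr(2)[OF k] e'] kernel_arr(3)[OF k] e(2)
      Comp_zero_left[OF e'] arr_Obj[OF t(2)] by simp
qed

lemma epic_of_exact_at_zero_object:
  assumes ex: "exact_at C X Y Z f z" and Z: "is_zero_object C Z"
  shows "is_epic C X Y f"
proof -
  note t = exact_at_Comp_zero(2)[OF ex]
  obtain e where e: "is_epic C X Y e" "f = Ident C Y \<bullet> e"
    using exact_at_factor[OF ex kernel_to_zero_object[OF t Z]] by blast
  then show ?thesis using Comp_Ident_left[OF epic_arr] by metis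
qed

lemma exact_at_zero_objectI:
  assumes f: "is_epic C X Y f" and z: "\<guillemotleft>z : Y \<rightarrow> Z\<guillemotright>" and Z: "is_zero_object C Z"
  shows "exact_at C X Y Z f z"
  using exact_atI[OF kernel_to_zero_object[OF z Z] f] Comp_Ident_left[OF epic_arr[OF f]] by simp

lemma ex_projective_cover_of_kernel:
  assumes "enough_projectives C" and f: "\<guillemotleft>f : X \<rightarrow> Y\<guillemotright>"
  obtains P g where "is_projective C P" "exact_at C P X Y g f"
proof -
  obtain K k where k: "is_kernel C X Y f K k" using ex_kernel[OF f] by blast
  moreover obtain P e where "is_projective C P" "is_epic C P K e"
    using assms arr_Obj kernel_arr[OF k] unfolding enough_projectives_def by metis
  ultimately show thesis using that exact_atI by blast
qed

lemma ex_projective_resolution: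
  assumes ep: "enough_projectives C" and X: "X \<in> Obj C"
  shows "\<exists>P d \<epsilon>. projective_resolution C X P d \<epsilon>"
proof -
  obtain P0 \<epsilon> where \<epsilon>: "is_projective C P0" "is_epic C P0 X \<epsilon>"
    using ep X unfolding enough_projectives_def by blast
  obtain P1 d0 where d0: "is_projective C P1" "exact_at C P1 P0 X d0 \<epsilon>"
    using ex_projective_cover_of_kernel[OF ep epic_arr[OF \<epsilon>(2)]] by blast
  \<comment> \<open>The state of the recursion is one differential with its source and target. The
    next differential covers the kernel of the current one, and its target is the current
    source.\<close>
  let ?good = "\<lambda>(P', P, d). is_projective C P' \<and> is_projective C P \<and> \<guillemotleft>d : P' \<rightarrow> P\<guillemotright>"
  let ?next = "\<lambda>(P', P, d) (Q', Q, d'). Q = P' \<and> exact_at C Q' P' P d' d"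
  have "\<exists>s. \<forall>n. (?good (s n) \<and> (n = 0 \<longrightarrow> s n = (P1, P0, d0))) \<and> ?next (s n) (s (Suc n))"
  proof (rule dependent_nat_choice)
    show "\<exists>x. ?good x \<and> (0 = 0 \<longrightarrow> x = (P1, P0, d0))"
      using d0 \<epsilon> exact_at_Comp_zero(1)[OF d0(2)] by (intro exI[of _ "(P1, P0, d0)"]) simp
    fix x :: "'o \<times> 'o \<times> 'm" and n :: nat assume x: "?good x \<and> (n = 0 \<longrightarrow> x = (P1, P0, d0))"
    obtain P' P d where xe: "x = (P', P, d)" by (cases x)
    have "\<guillemotleft>d : P' \<rightarrow> P\<guillemotright>" using x xe by simp
    then obtain Q d' where Q: "is_projective C Q" "exact_at C Q P' P d' d"
      by (rule ex_projective_cover_of_kernel[OF ep])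
    then show "\<exists>y. (?good y \<and> (Suc n = 0 \<longrightarrow> y = (P1, P0, d0))) \<and> ?next x y"
      using x xe exact_at_Comp_zero(1)[OF Q(2)] by (intro exI[of _ "(Q, P', d')"]) simp
  qed
  then obtain s :: "nat \<Rightarrow> 'o \<times> 'o \<times> 'm"
    where seq: "\<forall>n. (?good (s n) \<and> (n = 0 \<longrightarrow> s n = (P1, P0, d0))) \<and> ?next (s n) (s (Suc n))"
    by (rule exE)
  have s: "?good (s n)" "s 0 = (P1, P0, d0)" "?next (s n) (s (Suc n))" for n
    using seq[rule_format, of n] seq[rule_format, of 0] by simp_all
  define P where "P n = fst (snd (s n))" for n
  define d where "d n = snd (snd (s n))" for n
  have P_Suc: "P (Suc n) = fst (s n)" for n using s(3)[of n] by (auto simp: P_def split: prod.splits)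
  have "is_projective C (P n)" for n using s(1)[of n] by (auto simp: P_def split: prod.splits)
  moreover have "exact_at C (P (n + 2)) (P (n + 1)) (P n) (d (n + 1)) (d n)" for n
    using s(3)[of n] P_Suc[of n] P_Suc[of "Suc n"] by (auto simp: P_def d_def split: prod.splits)
  moreover have "exact_at C (P 1) (P 0) X (d 0) \<epsilon>"
    using d0(2) s(2) P_Suc[of 0] by (simp add: P_def d_def)
  moreover obtain Z where Z: "is_zero_object C Z" using ex_zero_object by blast
  moreover have "exact_at C (P 0) X Z \<epsilon> (zero_arr X Z)"
    using exact_at_zero_objectI[OF \<epsilon>(2) zero_arr_arr Z] X Z s(2) by (simp add: P_def is_zero_object_def)
  ultimately show ?thesis unfolding projective_resolution_def by blast
qed

lemma Ext_chosen_resolution: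
  assumes "enough_projectives C" and "X \<in> Obj C"
  obtains P d \<epsilon> where "projective_resolution C X P d \<epsilon>"
    "\<And>i Y. Ext C i X Y = cohomology_of C P d Y i"
proof -
  obtain P d \<epsilon> where sel: "(SOME (P, d, \<epsilon>). projective_resolution C X P d \<epsilon>) = (P, d, \<epsilon>)"
    by (metis prod_cases3)
  have "\<exists>x. case x of (P, d, \<epsilon>) \<Rightarrow> projective_resolution C X P d \<epsilon>"
    using ex_projective_resolution[OF assms] by auto
  from someI_ex[OF this] have "projective_resolution C X P d \<epsilon>" using sel by simp
  moreover have "Ext C i X Y = cohomology_of C P d Y i" for i Y unfolding Ext_def sel by simp
  ultimately show thesis by (rule that)
qed

text \<open>P and K are the start of the resolution that \<open>Ext\<close> itself uses. One syzygy
  K thus serves all Y, and the second equivalence is dimension shifting for that very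
  resolution.\<close>

lemma Ext_trivial_iff:
  assumes "enough_projectives C" and "X \<in> Obj C"
  obtains P K k e where "is_projective C P" "is_extension K P X k e"
    "\<forall>Y\<in>Obj C. trivial_group (Ext C 1 X Y) \<longleftrightarrow> ext1_zero X Y"
    "\<forall>Y\<in>Obj C. trivial_group (Ext C 2 X Y) \<longleftrightarrow> ext1_zero K Y"
proof -
  obtain P d \<epsilon> where res: "projective_resolution C X P d \<epsilon>"
    and Ext: "\<And>i Y. Ext C i X Y = cohomology_of C P d Y i"
    using Ext_chosen_resolution[OF assms] by metis
  have proj: "\<And>i. is_projective C (P i)" and ex0: "exact_at C (P 1) (P 0) X (d 0) \<epsilon>"
    and ex: "\<And>i. exact_at C (P (i + 2)) (P (i + 1)) (P i) (d (i + 1)) (d i)"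
    using res unfolding projective_resolution_def by blast+
  have \<epsilon>: "is_epic C (P 0) X \<epsilon>"
    using res epic_of_exact_at_zero_object unfolding projective_resolution_def by blast
  have ex1: "exact_at C (P (Suc (Suc 0))) (P (Suc 0)) (P 0) (d (Suc 0)) (d 0)"
    and ex2: "exact_at C (P (Suc (Suc (Suc 0)))) (P (Suc (Suc 0))) (P (Suc 0)) (d (Suc (Suc 0))) (d (Suc 0))"
    using ex[of 0] ex[of 1] by (simp_all add: numeral_2_eq_2)
  obtain K k where K: "is_extension K (P 0) X k \<epsilon>" using ex_extension[OF \<epsilon>] by blast
  note t = extension_arr[OF K]
  obtain e where e: "is_epic C (P (Suc 0)) K e" "d 0 = k \<bullet> e"
    using exact_at_factor[OF ex0 t(4)] by auto
  obtain L l where L: "is_extension L (P (Suc 0)) K l e" using ex_extension[OF e(1)] by blast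
  note s = extension_arr[OF L]
  \<comment> \<open>The kernel L of P 1 -> K is also the kernel of \<open>d 0\<close>, since
    \<open>k\<close> is monic. By exactness P 2 covers L, so degree 2 of the complex reads off the
    presentation L -> P 1 -> K.\<close>
  have "is_kernel C (P (Suc 0)) (P 0) (d 0) L l"
    using kernel_Comp_monic[OF s(4) kernel_monic[OF t(4)]] e(2) by simp
  then obtain c where c: "is_epic C (P (Suc (Suc 0))) L c" "d (Suc 0) = l \<bullet> c"
    using exact_at_factor[OF ex1] by blast
  note z1 = exact_at_Comp_zero[OF ex1] and z2 = exact_at_Comp_zero[OF ex2]
  show thesis
  proof (rule that[OF proj K]; intro ballI)
    fix Y assume Y: "Y \<in> Obj C"
    show "trivial_group (Ext C 1 X Y) \<longleftrightarrow> ext1_zero X Y"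
      unfolding Ext One_nat_def
      by (rule trans[OF trivial_cohomology_iff[of d 0 P, OF z1(2,1,3) Y, unfolded e(2)]
            trans[OF cocycles_factor_iff[OF ex1[unfolded e(2)] kernel_monic[OF t(4)] e(1)]
              ext1_zero_projective_presentation[OF K proj, symmetric]]])
    show "trivial_group (Ext C 2 X Y) \<longleftrightarrow> ext1_zero K Y"
      unfolding Ext numeral_2_eq_2
      by (rule trans[OF trivial_cohomology_iff[of d "Suc 0" P, OF z2(2,1,3) Y, unfolded c(2)]
            trans[OF cocycles_factor_iff[OF ex2[unfolded c(2)] kernel_monic[OF s(4)] c(1)]
              ext1_zero_projective_presentation[OF L proj, symmetric]]])
  qed
qed

end

section \<open>Resolving classes\<close>

text \<open>Projectives do not appear: \<open>enough\<close> only provides epics from \<A>, and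
  these serve as covers in the syzygy arguments below.\<close>

locale resolving_class = abelian_category C
  for C :: "('o, 'm) precategory" (structure) +
  fixes \<A> :: "'o set"
  assumes retract_closed:
      "\<lbrakk>A \<in> \<A>; \<guillemotleft>i : X \<rightarrow> A\<guillemotright>; \<guillemotleft>r : A \<rightarrow> X\<guillemotright>; r \<bullet> i = Ident C X\<rbrakk> \<Longrightarrow> X \<in> \<A>"
    and extension_closed: "\<lbrakk>is_extension K M X k e; K \<in> \<A>; X \<in> \<A>\<rbrakk> \<Longrightarrow> M \<in> \<A>"
    and kernel_closed: "\<lbrakk>is_extension K M X k e; M \<in> \<A>; X \<in> \<A>\<rbrakk> \<Longrightarrow> K \<in> \<A>"
    and enough: "X \<in> Obj C \<Longrightarrow> \<exists>A e. A \<in> \<A> \<and> is_epic C A X e"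
begin

lemma zero_object_mem:
  assumes Z: "is_zero_object C Z"
  shows "Z \<in> \<A>"
proof -
  have Z': "Z \<in> Obj C" using Z by (simp add: is_zero_object_def)
  obtain A e where A: "A \<in> \<A>" "is_epic C A Z e" using enough[OF Z'] by blast
  note e = epic_arr[OF A(2)]
  have z: "\<guillemotleft>zero_arr Z A : Z \<rightarrow> A\<guillemotright>" using zero_arr_arr Z' arr_Obj[OF e] by blast
  have "e \<bullet> zero_arr Z A = Ident C Z"
    using zero_object_arr_unique(1)[OF Z Comp_arr[OF e z] Ident_arr[OF Z']] .
  then show ?thesis using retract_closed[OF A(1) z e] by blast
qed

text \<open>The pullback of A and A' over X is an extension of A' by L, hence lies in \<A>. It is
  also an extension of A by L', so L' is the kernel of an epic within \<A>.\<close>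

lemma schanuel:
  assumes L: "is_extension L A X l a" and L': "is_extension L' A' X l' a'"
    and mem: "A \<in> \<A>" "A' \<in> \<A>" "L \<in> \<A>"
  shows "L' \<in> \<A>"
proof -
  obtain M p q where pb: "is_pullback A A' X a a' M p q"
    using ex_pullback_epic extension_arr(2,5) L L' by metis
  have "M \<in> \<A>" using pullback_extension[OF pb L] extension_closed mem by metis
  then show ?thesis
    using pullback_extension[OF is_pullback_sym[OF pb] L'] kernel_closed mem by metis
qed

text \<open>The step of the dimension shift: \<open>L\<close> and \<open>M\<close> have a common \<open>\<A>\<close>-syzygy \<open>N\<close>.\<close>

lemma restrict_cover:
  assumes M: "is_extension L M A l h" "A \<in> \<A>" and N: "is_extension N Q M n g" "Q \<in> \<A>"
  obtains U u v where "is_extension N U L u v" "U \<in> \<A>"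
proof -
  note t = extension_arr[OF M(1)] and s = extension_arr[OF N(1)]
  obtain U p q where pb: "is_pullback Q L M g l U p q" using ex_pullback_epic[OF s(5) t(1)] by blast
  \<comment> \<open>U is the preimage of L in Q, that is, the kernel of the composite epic Q -> M ->
    A between objects of \<A>.\<close>
  have "is_extension U Q A p (h \<bullet> g)"
    using pullback_of_kernel[OF pb t(4)] epic_Comp[OF s(5) t(5)] by (simp add: is_extension_def)
  then have "U \<in> \<A>" using kernel_closed M(2) N(2) by blast
  then show thesis using pullback_extension[OF pb N(1)] that by metis
qed

section \<open>Resolution dimension relative to \<A>, one syzygy at a time\<close>

primrec dim_le :: "nat \<Rightarrow> 'o set"
  where
    "dim_le 0 = \<A>"
  | "dim_le (Suc m) = {X. \<exists>L A k e. A \<in> \<A> \<and> L \<in> dim_le m \<and> is_extension L A X k e}"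

text \<open>The base case is the extension 0 -> X -> X, padding a resolution by a zero object. The
  locale does not place \<A> inside \<open>Obj C\<close>, so membership of X is a separate
  premise.\<close>

lemma dim_le_Suc: "X \<in> dim_le m \<Longrightarrow> X \<in> Obj C \<Longrightarrow> X \<in> dim_le (Suc m)"
proof (induction m arbitrary: X)
  case 0
  obtain Z where Z: "is_zero_object C Z" using ex_zero_object by blast
  note i = epic_Ident[OF 0(2)]
  have "is_monic C X X (Ident C X)"
    unfolding is_monic_def using Ident_arr[OF 0(2)] Comp_Ident_left by metis
  from kernel_of_monic[OF this Z] have "is_extension Z X X (zero_arr Z X) (Ident C X)"
    using i by (simp add: is_extension_def)
  then show ?case using 0 zero_object_mem[OF Z] by auto
next
  case (Suc m)
  then obtain L A k e where *: "A \<in> \<A>" "L \<in> dim_le m" "is_extension L A X k e" by auto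
  then have "L \<in> dim_le (Suc m)" using Suc.IH arr_Obj extension_arr(1) by blast
  then show ?case unfolding dim_le.simps(2)[of "Suc m"] using * by blast
qed

lemma dim_le_mono:
  assumes "m \<le> m'" "X \<in> dim_le m" "X \<in> Obj C"
  shows "X \<in> dim_le m'"
  using assms
proof (induction m' rule: dec_induct)
  case (step n)
  then show ?case using dim_le_Suc[of X n] by blast
qed

text \<open>The chain is cut into extensions of consecutive syzygies, the kernels K j of
  \<open>d j\<close>, and then read from its left end.\<close>

lemma dim_le_of_resolution:
  assumes "has_resolution_of_length C \<A> X m"
  shows "X \<in> dim_le m"
proof -
  obtain E d where ch: "exact_chain C (m + 3) E d" and E0: "is_zero_object C (E 0)" and E1: "E 1 = X"
    and mem: "\<And>j. j \<le> m \<Longrightarrow> E (j + 2) \<in> \<A>" and Z: "is_zero_object C (E (m + 3))"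
    using assms unfolding has_resolution_of_length_def by blast
  have ex: "exact_at C (E (j + 2)) (E (j + 1)) (E j) (d (j + 1)) (d j)" if "j \<le> m + 1" for j
    using ch that unfolding exact_chain_def by simp
  \<comment> \<open>As \<open>E 0\<close> is zero, the identity of X is a kernel of
    \<open>d 0\<close>. Fixing this choice at index 0 makes the syzygies start at X itself and not
    merely at an isomorphic object.\<close>
  have "\<exists>x. is_kernel C (E (j + 1)) (E j) (d j) (fst x) (snd x) \<and> (j = 0 \<longrightarrow> x = (X, Ident C X))"
    if "j \<le> m + 1" for j
  proof (cases "j = 0")
    case True
    then show ?thesis
      using kernel_to_zero_object[OF _ E0] exact_at_Comp_zero(2)[OF ex[OF that]] E1 by auto
  next
    case False
    then show ?thesis using ex_kernel[OF exact_at_Comp_zero(2)[OF ex[OF that]]] by auto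
  qed
  then obtain x where x: "\<And>j. j \<le> m + 1 \<Longrightarrow> is_kernel C (E (j + 1)) (E j) (d j) (fst (x j)) (snd (x j))"
    and x0: "x 0 = (X, Ident C X)" by (metis zero_le)
  define K k where "K j = fst (x j)" and "k j = snd (x j)" for j
  have K: "is_kernel C (E (j + 1)) (E j) (d j) (K j) (k j)" if "j \<le> m + 1" for j
    using x[OF that] by (simp add: K_def k_def)
  have ext: "\<exists>e. is_extension (K (j + 1)) (E (j + 2)) (K j) (k (j + 1)) e" if j: "j \<le> m" for j
  proof -
    obtain e where e: "is_epic C (E (j + 2)) (K j) e" "d (j + 1) = k j \<bullet> e"
      using exact_at_factor[OF ex K] trans_le_add1[OF j] by blast
    have "is_kernel C (E (j + 2)) (E (j + 1)) (k j \<bullet> e) (K (j + 1)) (k (j + 1))"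
      using K[of "j + 1"] j e(2) by simp
    then have "is_kernel C (E (j + 2)) (K j) e (K (j + 1)) (k (j + 1))"
      using kernel_of_Comp_monic[OF epic_arr[OF e(1)]] kernel_arr(2) kernel_monic
        K[OF trans_le_add1[OF j]] by blast
    then show ?thesis using e(1) unfolding is_extension_def by blast
  qed
  \<comment> \<open>The induction runs from the far end of the resolution towards X, which is
    \<open>K 0\<close>.\<close>
  have "K (m - j) \<in> dim_le j" if "j \<le> m" for j
    using that
  proof (induction j)
    case 0
    obtain e where e: "is_extension (K (m + 1)) (E (m + 2)) (K m) (k (m + 1)) e" using ext[of m] by blast
    have ex': "exact_at C (E (m + 3)) (E (m + 2)) (E (m + 1)) (d (m + 2)) (d (m + 1))"
      using ex[of "m + 1"] by (simp add: eval_nat_numeral)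
    have "is_kernel C (E (m + 2)) (E (m + 1)) (d (m + 1)) (K (m + 1)) (k (m + 1))"
      using K[of "m + 1"] by simp
    then obtain c where c: "is_epic C (E (m + 3)) (K (m + 1)) c" using exact_at_factor[OF ex'] by blast
    note c' = epic_arr[OF c]
    note obj = arr_Obj[OF c']
    \<comment> \<open>K (m + 1) is a quotient of the zero object \<open>E (m + 3)\<close>, so its
      identity vanishes. Hence \<open>e\<close> splits, and K m is a retract of
      \<open>E (m + 2)\<close>.\<close>
    have "Ident C (K (m + 1)) \<bullet> c = zero_arr (E (m + 3)) (K (m + 1))"
      using zero_object_arr_unique(2)[OF Z Comp_arr[OF Ident_arr[OF obj(2)] c'] zero_arr_arr[OF obj]] .
    then have "Ident C (K (m + 1)) = zero_arr (K (m + 1)) (K (m + 1))"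
      using epic_cancel_zero[OF c Ident_arr[OF obj(2)]] by blast
    then obtain s where "\<guillemotleft>s : K m \<rightarrow> E (m + 2)\<guillemotright>" "e \<bullet> s = Ident C (K m)"
      using extension_by_zero_split[OF e] by blast
    then show ?case using retract_closed[OF mem[OF order_refl]] extension_arr(2)[OF e] by simp
  next
    case (Suc j)
    define i where "i = m - Suc j"
    have "m - j = i + 1" using Suc.prems by (simp add: i_def)
    then have "K (i + 1) \<in> dim_le j" using Suc by simp
    moreover have "i \<le> m" by (simp add: i_def)
    ultimately have "K i \<in> dim_le (Suc j)"
      unfolding dim_le.simps using ext[of i] mem[of i] by blast
    then show ?case by (simp only: i_def)
  qed
  from this[of m] show ?thesis using x0 by (simp add: K_def)
qed

text \<open>Let I be the image and X the cokernel of \<open>f\<close>. Then I and the first syzygy L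
  of X in its short resolution are both kernels of maps onto X from \<A>, and K and X2 are their
  respective syzygies. A common syzygy N of L and I carries membership in \<A> from X2 to K.\<close>

lemma kernel_mem:
  assumes dim: "\<And>X. X \<in> Obj C \<Longrightarrow> X \<in> dim_le 2"
    and k: "is_kernel C A1 A0 f K k" and mem: "A1 \<in> \<A>" "A0 \<in> \<A>"
  shows "K \<in> \<A>"
proof -
  note f = kernel_arr(1)[OF k]
  obtain I m e X c where I: "is_extension I A0 X m c" "is_epic C A1 I e" "f = m \<bullet> e"
    by (rule epic_monic_factorization[OF f])
  note t = extension_arr[OF I(1)]
  have "is_kernel C A1 I e K k"
    using kernel_of_Comp_monic[OF epic_arr[OF I(2)] t(1) kernel_monic[OF t(4)]] k I(3) by simp
  then have K: "is_extension K A1 I k e" using I(2) by (simp add: is_extension_def)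
  have "X \<in> dim_le (Suc (Suc 0))" using dim arr_Obj(2)[OF t(2)] by (simp add: numeral_2_eq_2)
  then obtain X0 L l x X1 X2 l2 x2 where X0: "X0 \<in> \<A>" "is_extension L X0 X l x"
    and X1: "X1 \<in> \<A>" "X2 \<in> \<A>" "is_extension X2 X1 L l2 x2" by auto
  \<comment> \<open>M is the pullback of X0 and A0 over X. It is an extension of A0 by L and of X0
    by I; this symmetry is what links the two syzygies.\<close>
  obtain M p q where pb: "is_pullback X0 A0 X x c M p q"
    using ex_pullback_epic[OF extension_arr(5)[OF X0(2)] t(2)] by blast
  obtain l' where l': "is_extension L M A0 l' q" using pullback_extension[OF pb X0(2)] by blast
  obtain m' where m': "is_extension I M X0 m' p"
    using pullback_extension[OF is_pullback_sym[OF pb] I(1)] by blast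
  have "M \<in> Obj C" using arr_Obj(2) extension_arr(1)[OF l'] by blast
  then obtain Q g N n where Q: "Q \<in> \<A>" and N: "is_extension N Q M n g"
    using enough[of M] ex_extension by metis
  \<comment> \<open>Restricting the cover Q -> M to L and to I leaves its kernel N unchanged.
    Comparison with X2 -> X1 -> L puts N into \<A>; comparison with K -> A1 -> I then yields
    K.\<close>
  obtain U u v where "is_extension N U L u v" "U \<in> \<A>" using restrict_cover[OF l' mem(2) N Q] .
  then have "N \<in> \<A>" using schanuel[OF X1(3)] X1 by blast
  moreover obtain U' u' v' where "is_extension N U' I u' v'" "U' \<in> \<A>"
    using restrict_cover[OF m' X0(1) N Q] .
  ultimately show ?thesis using schanuel[OF _ K] mem by blast
qed

lemma envelope_unique_mapping:
  assumes dim: "\<And>X. X \<in> Obj C \<Longrightarrow> X \<in> dim_le 2" and env: "is_envelope C \<A> X A f"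
  shows "unique_mapping_property C \<A> X A f"
  unfolding unique_mapping_property_def Uniq_def
proof (intro ballI allI impI)
  fix A' g h h'
  assume A': "A' \<in> \<A>" and "\<guillemotleft>h : A \<rightarrow> A'\<guillemotright> \<and> g = h \<bullet> f" "\<guillemotleft>h' : A \<rightarrow> A'\<guillemotright> \<and> g = h' \<bullet> f"
  then have h: "\<guillemotleft>h : A \<rightarrow> A'\<guillemotright>" "\<guillemotleft>h' : A \<rightarrow> A'\<guillemotright>" and eq: "h \<bullet> f = h' \<bullet> f" by simp_all
  have A: "A \<in> \<A>" and f: "\<guillemotleft>f : X \<rightarrow> A\<guillemotright>"
    using env unfolding is_envelope_def is_preenvelope_def by blast+
  define d where "d = diff A A' h h'"
  have d: "\<guillemotleft>d : A \<rightarrow> A'\<guillemotright>" using diff_arr h d_def by simp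
  have df: "d \<bullet> f = zero_arr X A'"
    using Comp_diff_left[OF f h] eq diff_eq_zero_iff Comp_arr[OF h(2) f] d_def by simp
  obtain K k where k: "is_kernel C A A' d K k" using ex_kernel[OF d] by blast
  note t = kernel_arr[OF k]
  have K: "K \<in> \<A>" using kernel_mem[OF dim k A A'] by blast
  obtain u where u: "\<guillemotleft>u : X \<rightarrow> K\<guillemotright>" "k \<bullet> u = f" using kernel_lift[OF k f df] by blast
  obtain s where s: "\<guillemotleft>s : A \<rightarrow> K\<guillemotright>" "u = s \<bullet> f"
    using env K u(1) unfolding is_envelope_def is_preenvelope_def by blast
  have ks: "\<guillemotleft>k \<bullet> s : A \<rightarrow> A\<guillemotright>" using Comp_arr t s by blast
  have "(k \<bullet> s) \<bullet> f = f" using Comp_assoc[OF t(2) s(1) f] s(2) u(2) by simp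
  \<comment> \<open>A right inverse of \<open>k \<bullet> s\<close> is what forces \<open>d\<close>
    to vanish: \<open>d\<close> kills \<open>k\<close>, and the identity of A factors through
    \<open>k\<close>.\<close>
  then obtain v where v: "\<guillemotleft>v : A \<rightarrow> A\<guillemotright>" "(k \<bullet> s) \<bullet> v = Ident C A"
    using env ks unfolding is_envelope_def is_automorphism_def by blast
  have sv: "\<guillemotleft>s \<bullet> v : A \<rightarrow> K\<guillemotright>" using Comp_arr s v by blast
  have "d = d \<bullet> (k \<bullet> (s \<bullet> v))"
    using Comp_assoc[OF t(2) s(1) v(1)] v(2) Comp_Ident_right[OF d] by simp
  also have "\<dots> = zero_arr A A'"
    using Comp_assoc[OF d t(2) sv] t(3) Comp_zero_left[OF sv] arr_Obj[OF d] by simp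
  finally show "h = h'" using diff_eq_zero_iff[OF h] d_def by simp
qed

lemma resolution_of_unique_mapping:
  assumes ump: "\<And>X. X \<in> Obj C \<Longrightarrow> \<exists>A f. is_preenvelope C \<A> X A f \<and> unique_mapping_property C \<A> X A f"
    and X: "X \<in> Obj C"
  shows "has_resolution_of_length C \<A> X 2"
proof -
  obtain A0 e0 where A0: "A0 \<in> \<A>" "is_epic C A0 X e0" using enough[OF X] by blast
  obtain K0 k0 where K0: "is_extension K0 A0 X k0 e0" using ex_extension[OF A0(2)] by blast
  note t0 = extension_arr[OF K0]
  have "K0 \<in> Obj C" using arr_Obj t0 by blast
  then obtain A1 e1 where A1: "A1 \<in> \<A>" "is_epic C A1 K0 e1" using enough by blast
  obtain K1 k1 where K1: "is_extension K1 A1 K0 k1 e1" using ex_extension[OF A1(2)] by blast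
  note t1 = extension_arr[OF K1]
  define f where "f = k0 \<bullet> e1"
  have f: "is_kernel C A1 A0 f K1 k1"
    using kernel_Comp_monic[OF t1(4) kernel_monic[OF t0(4)]] f_def by simp
  note tf = kernel_arr[OF f]
  have obj: "K1 \<in> Obj C" "A0 \<in> Obj C" "A1 \<in> Obj C" using arr_Obj t0 t1 by blast+
  obtain B \<phi> where pre: "is_preenvelope C \<A> K1 B \<phi>" and uniq: "unique_mapping_property C \<A> K1 B \<phi>"
    using ump[OF obj(1)] by blast
  have B: "B \<in> \<A>" and \<phi>: "\<guillemotleft>\<phi> : K1 \<rightarrow> B\<guillemotright>" using pre unfolding is_preenvelope_def by blast+
  have B': "B \<in> Obj C" using arr_Obj \<phi> by blast
  obtain h where h: "\<guillemotleft>h : B \<rightarrow> A1\<guillemotright>" "k1 = h \<bullet> \<phi>"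
    using pre A1(1) tf(2) unfolding is_preenvelope_def by blast
  have fh: "\<guillemotleft>f \<bullet> h : B \<rightarrow> A0\<guillemotright>" using Comp_arr tf h by blast
  have "(f \<bullet> h) \<bullet> \<phi> = zero_arr K1 A0" using Comp_assoc[OF tf(1) h(1) \<phi>] h(2) tf(3) by simp
  \<comment> \<open>Both \<open>f \<bullet> h\<close> and the zero arrow extend the zero arrow K1 ->
    A0 along \<open>\<phi>\<close>, so uniqueness identifies them.\<close>
  moreover have "zero_arr B A0 \<bullet> \<phi> = zero_arr K1 A0" using Comp_zero_left[OF \<phi> obj(2)] .
  ultimately have "f \<bullet> h = zero_arr B A0"
    using uniq A0(1) fh zero_arr_arr[OF B' obj(2)] zero_arr_arr[OF obj(1,2)]
    unfolding unique_mapping_property_def Uniq_def by metis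
  then obtain r where r: "\<guillemotleft>r : B \<rightarrow> K1\<guillemotright>" "k1 \<bullet> r = h" using kernel_lift[OF f h(1)] by blast
  have "k1 \<bullet> (r \<bullet> \<phi>) = k1 \<bullet> Ident C K1"
    using Comp_assoc[OF tf(2) r(1) \<phi>] r(2) h(2) Comp_Ident_right[OF tf(2)] by simp
  then have "r \<bullet> \<phi> = Ident C K1"
    using kernel_cancel[OF f Comp_arr[OF r(1) \<phi>] Ident_arr[OF obj(1)]] by blast
  then have K1_mem: "K1 \<in> \<A>" using retract_closed[OF B \<phi> r(1)] by blast
  obtain Z where Z: "is_zero_object C Z" using ex_zero_object by blast
  then have Z': "Z \<in> Obj C" by (simp add: is_zero_object_def)
  have "exact_at C A0 X Z e0 (zero_arr X Z)"
    using exact_at_zero_objectI[OF A0(2) zero_arr_arr[OF X Z'] Z] .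
  moreover have "exact_at C A1 A0 X f e0" using exact_atI[OF t0(4) A1(2)] f_def by simp
  moreover have "exact_at C K1 A1 A0 k1 f"
    using exact_atI[OF f epic_Ident[OF obj(1)]] Comp_Ident_right[OF tf(2)] by simp
  moreover have "exact_at C Z K1 A1 (zero_arr Z K1) k1"
    using exact_atI[OF kernel_of_monic[OF kernel_monic[OF f] Z] epic_Ident[OF Z']]
      Comp_Ident_right[OF zero_arr_arr[OF Z' obj(1)]] by simp
  \<comment> \<open>The lists follow the indexing from right to left: 0, X, then the three terms of
    the resolution, then 0. The differential with index j goes from entry j + 1 to entry j.\<close>
  ultimately have "exact_chain C (2 + 3) ((!) [Z, X, A0, A1, K1, Z]) ((!) [zero_arr X Z, e0, f, k1, zero_arr Z K1])"
    unfolding exact_chain_def by (auto simp: numeral_eq_Suc le_Suc_eq)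
  moreover have "\<forall>j\<le>2. [Z, X, A0, A1, K1, Z] ! (j + 2) \<in> \<A>"
    using A0(1) A1(1) K1_mem by (auto simp: numeral_eq_Suc le_Suc_eq)
  moreover have "[Z, X, A0, A1, K1, Z] ! (2 + 3) = Z" by (simp add: numeral_eq_Suc)
  ultimately show ?thesis
    unfolding has_resolution_of_length_def
    using Z by (intro exI[of _ "(!) [Z, X, A0, A1, K1, Z]"]
        exI[of _ "(!) [zero_arr X Z, e0, f, k1, zero_arr Z K1]"]) simp
qed

end

section \<open>The left orthogonal class as a resolving class, and the equivalence\<close>

text \<open>A finite bound excludes the empty set, whose infimum is infinite, and the infimum of a
  nonempty set in \<open>enat\<close> is attained.\<close>

lemma resdim_le_iff:
  "resdim C \<X> X \<le> enat m \<longleftrightarrow> (\<exists>k\<le>m. has_resolution_of_length C \<X> X k)"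
proof
  let ?S = "enat ` {m. has_resolution_of_length C \<X> X m}"
  assume le: "resdim C \<X> X \<le> enat m"
  then have "?S \<noteq> {}" unfolding resdim_def Inf_enat_def by (auto split: if_splits)
  then have "Inf ?S \<in> ?S" using LeastI_ex[of "\<lambda>x. x \<in> ?S"] by (auto simp: Inf_enat_def)
  then show "\<exists>k\<le>m. has_resolution_of_length C \<X> X k" using le unfolding resdim_def by auto
next
  assume "\<exists>k\<le>m. has_resolution_of_length C \<X> X k"
  then show "resdim C \<X> X \<le> enat m" unfolding resdim_def by (auto intro: Inf_lower2)
qed

lemma (in abelian_category) left_perp1_iff:
  assumes "enough_projectives C" and "\<B> \<subseteq> Obj C"
  shows "X \<in> left_perp1 C \<B> \<longleftrightarrow> X \<in> Obj C \<and> (\<forall>Y\<in>\<B>. ext1_zero X Y)"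
proof (cases "X \<in> Obj C")
  case True
  have "trivial_group (Ext C 1 X Y) \<longleftrightarrow> ext1_zero X Y" if "Y \<in> \<B>" for Y
    by (rule Ext_trivial_iff[OF assms(1) True]) (use that assms(2) in blast)
  then show ?thesis using True by (simp add: left_perp1_def Ext_vanishes_def)
qed (simp add: left_perp1_def)

text \<open>Only closure under kernels of epics needs the second degree. For M -> X with kernel K,
  take a projective presentation P -> X; its kernel L is orthogonal to \<B> because Ext^2 vanishes.
  The pullback of P and M over X is an extension of M by L, hence in the class. It is also an
  extension of P by K, which splits, so K is a retract of it.\<close>

lemma (in abelian_category) resolving_class_left_perp1:
  assumes ep: "enough_projectives C" and \<B>: "\<B> \<subseteq> Obj C"
    and ext2: "Ext_vanishes C 2 (left_perp1 C \<B>) \<B>"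
  shows "resolving_class C (left_perp1 C \<B>)"
proof
  let ?A = "left_perp1 C \<B>"
  note mem_iff = left_perp1_iff[OF ep \<B>]
  show retract: "X \<in> ?A"
    if "A \<in> ?A" "\<guillemotleft>i : X \<rightarrow> A\<guillemotright>" "\<guillemotleft>r : A \<rightarrow> X\<guillemotright>" "r \<bullet> i = Ident C X" for A X i r
    using that(1) ext1_zero_retract[OF _ that(2-4)] arr_Obj(1)[OF that(2)] unfolding mem_iff by blast
  show extension: "M \<in> ?A" if "is_extension K M X k e" "K \<in> ?A" "X \<in> ?A" for K M X k e
    using that(2,3) ext1_zero_extension[OF that(1)] arr_Obj(2)[OF extension_arr(1)[OF that(1)]]
    unfolding mem_iff by blast
  show "\<exists>A e. A \<in> ?A \<and> is_epic C A X e" if X: "X \<in> Obj C" for X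
  proof -
    obtain P e where "is_projective C P" "is_epic C P X e"
      using ep X unfolding enough_projectives_def by blast
    then show ?thesis
      using ext1_zero_projective unfolding mem_iff is_projective_def by blast
  qed
  show "K \<in> ?A" if K: "is_extension K M X k e" and M: "M \<in> ?A" and X: "X \<in> ?A" for K M X k e
  proof -
    have X': "X \<in> Obj C" using X mem_iff by blast
    obtain P L l p where P: "is_projective C P" and L: "is_extension L P X l p"
      and "\<forall>Y\<in>Obj C. trivial_group (Ext C 1 X Y) \<longleftrightarrow> ext1_zero X Y"
      and Ext2: "\<forall>Y\<in>Obj C. trivial_group (Ext C 2 X Y) \<longleftrightarrow> ext1_zero L Y"
      by (rule Ext_trivial_iff[OF ep X'])
    have "ext1_zero L Y" if "Y \<in> \<B>" for Y
      using Ext2 that \<B> ext2 X unfolding Ext_vanishes_def by blast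
    then have L_mem: "L \<in> ?A"
      using arr_Obj(1)[OF extension_arr(1)[OF L]] mem_iff by simp
    obtain U a b where pb: "is_pullback P M X p e U a b"
      using ex_pullback_epic[OF extension_arr(5)[OF L] extension_arr(2)[OF K]] by blast
    obtain l' where "is_extension L U M l' b" using pullback_extension[OF pb L] by blast
    then have U: "U \<in> ?A" using extension L_mem M by blast
    obtain k' where k': "is_extension K U P k' a"
      using pullback_extension[OF is_pullback_sym[OF pb] K] by blast
    obtain r where "\<guillemotleft>r : U \<rightarrow> K\<guillemotright>" "r \<bullet> k' = Ident C K" using extension_split[OF k' P] by blast
    then show ?thesis using retract[OF U extension_arr(1)[OF k']] by blast
  qed
qed

theorem corollary3p17:
  fixes C :: "('o, 'm) precategory" and \<A> \<B> :: "'o set" and n :: nat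
  assumes "abelian_category C"
    and "enough_projectives C"
    and "left_n_cotorsion_pair C n \<A> \<B>"
    and "3 \<le> n"
    and "\<A> = left_perp1 C \<B>"
  shows "(\<forall>X\<in>Obj C. \<exists>A f. is_envelope C \<A> X A f \<and> unique_mapping_property C \<A> X A f)
     \<longleftrightarrow> ((\<forall>X\<in>Obj C. \<exists>A f. is_envelope C \<A> X A f) \<and> (\<forall>X\<in>Obj C. resdim C \<A> X \<le> 2))"
proof -
  interpret abelian_category C by fact
  \<comment> \<open>Since n is at least 3, degree 2 is among the degrees in which the pair has
    vanishing \<open>Ext\<close>.\<close>
  have "\<B> \<subseteq> Obj C" "Ext_vanishes C 2 \<A> \<B>"
    using assms(3,4) unfolding left_n_cotorsion_pair_def by auto
  then interpret resolving_class C \<A>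
    using resolving_class_left_perp1[OF assms(2)] assms(5) by simp
  have resdim: "resdim C \<A> X \<le> 2 \<longleftrightarrow> (\<exists>m\<le>2. has_resolution_of_length C \<A> X m)" for X
    using resdim_le_iff[of C \<A> X 2] by (simp add: numeral_eq_enat)
  show ?thesis
  proof
    assume ump: "\<forall>X\<in>Obj C. \<exists>A f. is_envelope C \<A> X A f \<and> unique_mapping_property C \<A> X A f"
    then have "has_resolution_of_length C \<A> X 2" if "X \<in> Obj C" for X
      using resolution_of_unique_mapping[OF _ that] unfolding is_envelope_def by blast
    then show "(\<forall>X\<in>Obj C. \<exists>A f. is_envelope C \<A> X A f) \<and> (\<forall>X\<in>Obj C. resdim C \<A> X \<le> 2)"
      using ump resdim by blast
  next
    assume b: "(\<forall>X\<in>Obj C. \<exists>A f. is_envelope C \<A> X A f) \<and> (\<forall>X\<in>Obj C. resdim C \<A> X \<le> 2)"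
    \<comment> \<open>The resolution at hand may be shorter than 2; \<open>dim_le_mono\<close>
      brings all lengths to the uniform bound.\<close>
    then have "X \<in> dim_le 2" if "X \<in> Obj C" for X
      using that resdim dim_le_of_resolution dim_le_mono by blast
    then show "\<forall>X\<in>Obj C. \<exists>A f. is_envelope C \<A> X A f \<and> unique_mapping_property C \<A> X A f"
      using b envelope_unique_mapping by blast
  qed
qed

end
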